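(* Let $\ell$ and $k$ be integers satisfying $0\leq \ell< k/2$, and let $1/2<\alpha\leq 1$. Then for every $\gamma>0$ there is $n_0$ such that for every integer $n\geq n_0$ the following holds. Suppose that $(k-\ell)\mid n$, $\mathcal H$ is a $k$-uniform hypergraph on $n$ vertices, and $\delta_{k-1}(\mathcal H)\geq \alpha n$. Then the number of Hamilton $\ell$-cycles in $\mathcal H$ is at least $$(1-\gamma)^n\cdot n!\cdot \left(\frac{\alpha}{\ell!\,(k-2\ell)!}\right)^{\frac{n}{k-\ell}}.$$
   Context: For a $k$-uniform hypergraph $\mathcal H$ and a $d$-subset $A\subseteq V(\mathcal H)$, $d_{\mathcal H}(A)$ is the number of edges $f\in E(\mathcal H)$ with $A\subseteq f$, and $\delta_d(\mathcal H)=\min\{d_{\mathcal H}(A): A\subseteq V(\mathcal H),\ |A|=d\}$. For $0\leq \ell<k$, a $(k,\ell)$-cycle is a $k$-uniform hypergraph whose vertices can be ordered cyclically such that the edges are segments (of $k$ consecutive vertices) of that order and every two consecutive edges share exactly $\ell$ vertices. A Hamilton $\ell$-cycle of $\mathcal H$ is a sub-hypergraph of $\mathcal H$ which is a $(k,\ell)$-cycle using all vertices of $\mathcal H$ (for $\ell=0$ this is a perfect matching). The paper writes the bound as $(1-o(1))^n\cdot n!\cdot(\alpha/(\ell!(k-2\ell)!))^{n/(k-\ell)}$ with $o(1)\to 0$ as $n\to\infty$.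
   Formalization: For ℓ=0 the stated bound fails (complete hypergraphs have too few perfect matchings), so there the number of perfect matchings is multiplied by (n/k)!; also k≥2 and γ<1 are assumed, as the claim fails for k=1 and for γ>2. *)

theory Defs
  imports Complex_Main
begin

definition uniform_hypergraph :: "nat \<Rightarrow> 'a set \<Rightarrow> 'a set set \<Rightarrow> bool" where
  "uniform_hypergraph k V E \<longleftrightarrow> finite V \<and> (\<forall>e\<in>E. e \<subseteq> V \<and> card e = k)"

definition hyp_degree :: "'a set set \<Rightarrow> 'a set \<Rightarrow> nat" where
  "hyp_degree E A = card {f \<in> E. A \<subseteq> f}"

text \<open>Only meaningful for \<open>d \<le> card V\<close>; otherwise it is the minimum of the empty set.\<close>

definition min_hyp_degree :: "nat \<Rightarrow> 'a set \<Rightarrow> 'a set set \<Rightarrow> nat" where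
  "min_hyp_degree d V E = Min {hyp_degree E A | A. A \<subseteq> V \<and> card A = d}"

text \<open>A cyclic order of the vertices is represented by a distinct list, read cyclically.\<close>

definition segment :: "nat \<Rightarrow> 'a list \<Rightarrow> nat \<Rightarrow> 'a set" where
  "segment k xs s = {xs ! ((s + j) mod length xs) | j. j < k}"

text \<open>
  The list \<open>ss\<close> holds the starting positions of the edges in increasing order, so that
  \<open>ss ! i\<close> and \<open>ss ! (Suc i mod length ss)\<close> start cyclically consecutive edges.
  The condition \<open>\<Union>C = V\<close> says that there are no isolated vertices; without it, the
  case \<open>l = 0\<close> would allow gaps between disjoint edges and not yield perfect matchings.
\<close>

definition kl_cycle :: "nat \<Rightarrow> nat \<Rightarrow> 'a set \<Rightarrow> 'a set set \<Rightarrow> bool" where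
  "kl_cycle k l V C \<longleftrightarrow> (\<exists>xs ss.
     distinct xs \<and> set xs = V \<and> k \<le> length xs \<and>
     sorted_wrt (<) ss \<and> set ss \<subseteq> {..<length xs} \<and>
     C = segment k xs ` set ss \<and> \<Union>C = V \<and>
     (\<forall>i<length ss. Suc i mod length ss \<noteq> i \<longrightarrow>
        card (segment k xs (ss ! i) \<inter> segment k xs (ss ! (Suc i mod length ss))) = l))"

definition hamilton_cycles :: "nat \<Rightarrow> nat \<Rightarrow> 'a set \<Rightarrow> 'a set set \<Rightarrow> 'a set set set" where
  "hamilton_cycles k l V E = {C. C \<subseteq> E \<and> kl_cycle k l V C}"

end

theory Submission
  imports Defs "HOL-Analysis.Analysis" "HOL-Combinatorics.Multiset_Permutations"
    "HOL-Computational_Algebra.Fundamental_Theorem_Algebra" "HOL-Real_Asymp.Real_Asymp"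
begin

text \<open>
  Since \<open>l < k / 2\<close>, each of the \<open>m = n / (k - l)\<close> edges of a cyclic order has a position lying in
  no other edge; call one such position per edge special. Fix the vertices at all other positions.
  Completing them to a Hamilton cycle means matching the \<open>m\<close> remaining vertices with the \<open>m\<close> partial
  edges, that is, finding a permutation counted by the permanent of a 0-1 matrix. For all but a small
  proportion of the choices every row and column of that matrix has at least \<open>(\<alpha> - \<epsilon>) m\<close> ones: the
  zeros in a line are handled by bounding the probability that all members of a given linear-sized
  set of entries vanish, revealing one vertex per entry.

  If every line of an \<open>m \<times> m\<close> matrix has at least \<open>d \<ge> m / 2\<close> ones, its permanent is at least
  \<open>(d / e)\<^sup>m\<close>. This follows from Gurvits' inequality, by which the permanent is at least \<open>e\<^bsup>-m\<^esup>\<close> times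
  the infimum of \<open>\<Prod>\<^sub>i (A x)\<^sub>i / \<Prod>\<^sub>j x\<^sub>j\<close> over positive \<open>x\<close>, together with the fact that this infimum
  is at least \<open>d\<^sup>m\<close>. Dividing by the number of cyclic orders per cycle gives the count.
\<close>

section \<open>Permanents and Gurvits' capacity inequality\<close>

text \<open>The matrix left after fixing the other vertices has line sums that are bounded below but
  not equal, and a bipartite graph of minimum degree \<open>d\<close> need not contain a spanning
  \<open>d\<close>-regular subgraph. Passing to a doubly stochastic matrix would thus lose density;
  the capacity is estimated for the matrix itself. Its zeros have line sums at most
  \<open>z = m - d\<close>, a worst pattern of zeros (with entries allowed to exceed 1) is found by
  rearrangement, and for that pattern a one-variable logarithmic inequality suffices. This needs
  \<open>z\<close> at most \<open>d\<close>, which is where \<alpha> > 1/2 enters; below one half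
  such a permanent can vanish. The factor e^(-m) is not a loss: valid completions are compared with
  all m! completions of the same fixed part, and m! is (m/e)^m up to a polynomial factor, so their
  proportion is about \<alpha>^m. It is enough that half of all orders satisfy the line conditions,
  but there are 2m of these, so each may fail only with probability O(1/m); the moment argument
  makes it exponentially small.\<close>

text \<open>The polynomial \<open>D\<^sub>c \<dots> D\<^sub>c' \<Prod>\<^bsub>i \<in> I\<^esub> y\<^sub>i\<close>, differentiated in the directions of the list. It does not
  depend on \<open>y\<close> when the list is as long as \<open>I\<close> is large; it is then the permanent of the matrix
  with these columns.\<close>

fun mixed_perm :: "'b set \<Rightarrow> ('b \<Rightarrow> 'c::comm_semiring_1) list \<Rightarrow> ('b \<Rightarrow> 'c) \<Rightarrow> 'c" where
  "mixed_perm I [] y = (\<Prod>i\<in>I. y i)"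
| "mixed_perm I (c # C) y = (\<Sum>i\<in>I. c i * mixed_perm (I - {i}) C y)"

abbreviation line_poly :: "'b set \<Rightarrow> ('b \<Rightarrow> 'c::field_char_0) list \<Rightarrow> ('b \<Rightarrow> 'c) \<Rightarrow> ('b \<Rightarrow> 'c) \<Rightarrow> 'c poly" where
  "line_poly I C y d \<equiv> mixed_perm I (map (\<lambda>c i. [:c i:]) C) (\<lambda>i. [:y i, d i:])"

lemma pderiv_sum: "pderiv (sum f A) = (\<Sum>x\<in>A. pderiv (f x))"
  using higher_pderiv_sum[of 1 f A] by simp

lemma poly_line_poly: "poly (line_poly I C y d) t = mixed_perm I C (\<lambda>i. y i + t * d i)"
  by (induction C arbitrary: I) (simp_all add: poly_prod poly_sum)

text \<open>The derivative along the line acts on the product, innermost in the recursion, which is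
  why \<open>d\<close> joins the list at its end; hence the reverse induction in
  \<open>mixed_perm_stable\<close>.\<close>

lemma poly_pderiv_line_poly:
  assumes "finite I"
  shows "poly (pderiv (line_poly I C y d)) t = mixed_perm I (C @ [d]) (\<lambda>i. y i + t * d i)"
  using assms
proof (induction C arbitrary: I)
  case Nil
  then show ?case
    by (auto simp: pderiv_prod poly_sum poly_prod pderiv_pCons mult.commute intro!: sum.cong)
next
  case (Cons c C)
  then show ?case by (simp add: pderiv_sum poly_sum pderiv_smult)
qed

text \<open>\<open>mixed_perm I C\<close> is homogeneous of degree \<open>card I - length C\<close>,
  so its restriction to a line has its value at the direction \<open>d\<close> as top
  coefficient.\<close>

lemma degree_line_poly:
  assumes "finite I" "length C \<le> card I"
  shows "degree (line_poly I C y d) \<le> card I - length C"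
    and "coeff (line_poly I C y d) (card I - length C) = mixed_perm I C d"
proof -
  have "degree (line_poly I C y d) \<le> card I - length C \<and>
     coeff (line_poly I C y d) (card I - length C) = mixed_perm I C d"
    using assms
  proof (induction C arbitrary: I)
    case Nil
    have "degree (\<Prod>i\<in>I. [:y i, d i:]) \<le> card I \<and> coeff (\<Prod>i\<in>I. [:y i, d i:]) (card I) = (\<Prod>i\<in>I. d i)"
      using Nil(1)
    proof (induction I)
      case (insert a I)
      have "degree ([:y a, d a:] * (\<Prod>i\<in>I. [:y i, d i:])) \<le> 1 + card I"
        using insert by (intro order.trans[OF degree_mult_le] add_mono) auto
      moreover have "coeff (\<Prod>i\<in>I. [:y i, d i:]) (Suc (card I)) = 0"
        using insert by (intro coeff_eq_0) auto
      ultimately show ?case using insert by (simp)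
    qed simp
    then show ?case by simp
  next
    case (Cons c C)
    have 1: "length C \<le> card (I - {i})" "finite (I - {i})" 
       "card (I - {i}) - length C = card I - length (c # C)" if "i \<in> I" for i
      using that Cons.prems by auto
    have "degree (line_poly I (c # C) y d) \<le> card I - length (c # C)"
      unfolding list.map mixed_perm.simps
    proof (intro degree_sum_le)
      fix i assume i: "i \<in> I"
      show "degree ([:c i:] * line_poly (I - {i}) C y d) \<le> card I - length (c # C)"
        using Cons.IH[OF 1(2)[OF i] 1(1)[OF i]] 1(3)[OF i]
        by (intro order.trans[OF degree_mult_le]) simp
    qed (use Cons in auto)
    moreover have "coeff (line_poly I (c # C) y d) (card I - length (c # C)) = mixed_perm I (c # C) d"
      unfolding list.map mixed_perm.simps coeff_sum
    proof (intro sum.cong refl)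
      fix i assume i: "i \<in> I"
      show "coeff ([:c i:] * line_poly (I - {i}) C y d) (card I - length (c # C)) = c i * mixed_perm (I - {i}) C d"
        using Cons.IH[OF 1(2)[OF i] 1(1)[OF i]] 1(3)[OF i] by simp
    qed
    ultimately show ?case by blast
  qed
  then show "degree (line_poly I C y d) \<le> card I - length C"
    and "coeff (line_poly I C y d) (card I - length C) = mixed_perm I C d" by auto
qed

text \<open>Logarithmic derivative at 0; both the stability and the exponential bound read the
  directional derivative off the roots.\<close>

lemma poly_pderiv_roots:
  fixes a :: "'c::field_char_0" and D :: nat
  assumes p: "p = smult a (\<Prod>i<D. [:- r i, 1:])" and nz: "\<And>i. i < D \<Longrightarrow> r i \<noteq> 0"
  shows "poly (pderiv p) 0 = poly p 0 * (\<Sum>i<D. - 1 / r i)"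
proof -
  have "poly (pderiv (\<Prod>i<D. [:- r i, 1:])) 0 = (\<Sum>i<D. (\<Prod>j\<in>{..<D} - {i}. - r j))"
    by (simp add: pderiv_prod poly_sum poly_prod pderiv_pCons)
  also have "\<dots> = (\<Sum>i<D. (\<Prod>j<D. - r j) * (- 1 / r i))"
  proof (intro sum.cong refl)
    fix i assume i: "i \<in> {..<D}"
    then have "(\<Prod>j<D. - r j) = - r i * (\<Prod>j\<in>{..<D} - {i}. - r j)"
      by (intro prod.remove) auto
    with nz i show "(\<Prod>j\<in>{..<D} - {i}. - r j) = (\<Prod>j<D. - r j) * (- 1 / r i)" by simp
  qed
  finally show ?thesis
    by (simp add: p pderiv_smult poly_prod sum_distrib_left mult.assoc)
qed

lemma mixed_perm_of_real:
  "mixed_perm I (map (\<lambda>c i. of_real (c i)) C) (\<lambda>i. of_real (y i)) = 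
    (of_real (mixed_perm I C y) :: 'a :: {comm_semiring_1, real_algebra_1})"
  by (induction C arbitrary: I) simp_all

lemma mixed_perm_pos:
  fixes C :: "('b \<Rightarrow> real) list"
  assumes "finite I" "length C \<le> card I" "\<And>c i. c \<in> set C \<Longrightarrow> i \<in> I \<Longrightarrow> 0 < c i" "\<And>i. i \<in> I \<Longrightarrow> 0 < y i"
  shows "0 < mixed_perm I C y"
  using assms
proof (induction C arbitrary: I)
  case (Cons c C)
  have "0 < c i * mixed_perm (I - {i}) C y" if "i \<in> I" for i
    using that Cons.prems by (intro mult_pos_pos Cons.IH) auto
  moreover have "I \<noteq> {}" using Cons.prems by auto
  ultimately show ?case using Cons.prems(1) by (auto intro!: sum_pos)
qed (auto intro: prod_pos)

abbreviation cmap :: "('b \<Rightarrow> real) list \<Rightarrow> ('b \<Rightarrow> complex) list" where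
  "cmap C \<equiv> map (\<lambda>c i. complex_of_real (c i)) C"

lemma complex_poly_roots:
  fixes p :: "complex poly"
  obtains r where "p = smult (lead_coeff p) (\<Prod>i<degree p. [:- r i, 1:])"
    "\<And>i. i < degree p \<Longrightarrow> poly p (r i) = 0"
proof -
  obtain r where r: "smult (lead_coeff p) (\<Prod>i<degree p. [:- r i, 1:]) = p"
    by (rule complex_poly_decompose')
  have "poly p (r i) = 0" if "i < degree p" for i
    by (subst r[symmetric]) (use that in \<open>auto simp: poly_prod intro!: prod_zero\<close>)
  with r show ?thesis by (intro that) auto
qed

text \<open>The half-plane \<open>Re (u * z) > 0\<close> is arbitrary, since real-rootedness below needs both the
  upper and the lower one.\<close>

lemma mixed_perm_stable:
  fixes u :: complex
  assumes "finite I" "length C \<le> card I" "\<And>c i. c \<in> set C \<Longrightarrow> i \<in> I \<Longrightarrow> 0 < c i" 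
    and "\<And>i. i \<in> I \<Longrightarrow> 0 < Re (u * y i)"
  shows "mixed_perm I (cmap C) y \<noteq> 0"
  using assms
proof (induction C arbitrary: y rule: rev_induct)
  case Nil
  then show ?case by fastforce
next
  case (snoc d C)
  let ?p = "line_poly I (cmap C) y (\<lambda>i. of_real (d i))"
  have nz: "poly ?p t \<noteq> 0" if "Re (u * t) \<ge> 0" for t
    unfolding poly_line_poly
  proof (rule snoc.IH)
    fix i assume i: "i \<in> I"
    have "Re (u * (y i + t * of_real (d i))) = Re (u * y i) + d i * Re (u * t)"
      by (simp add: algebra_simps)
    also have "\<dots> > 0" using snoc.prems(4)[OF i] snoc.prems(3)[of d i] i that
      by (intro add_pos_nonneg) auto
    finally show "0 < Re (u * (y i + t * of_real (d i)))" .
  qed (use snoc.prems in auto)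
  have p0: "poly ?p 0 \<noteq> 0" by (rule nz) simp
  \<comment> \<open>A root is needed, since an empty sum of reciprocals would vanish: the top
    coefficient is a positive number, hence the degree is positive.\<close>
  have "coeff ?p (card I - length C) = complex_of_real (mixed_perm I C d)"
    using degree_line_poly(2)[of I "cmap C"] snoc.prems by (simp add: mixed_perm_of_real)
  also have "\<dots> \<noteq> 0"
    using mixed_perm_pos[of I C d] snoc.prems by (simp add: less_eq_real_def)
  finally have "degree ?p \<ge> card I - length C" by (rule le_degree)
  then have deg: "degree ?p > 0" using snoc.prems by simp
  obtain r where r: "?p = smult (lead_coeff ?p) (\<Prod>i<degree ?p. [:- r i, 1:])"
    and root: "\<And>i. i < degree ?p \<Longrightarrow> poly ?p (r i) = 0"
    using complex_poly_roots[of ?p] by blast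
  have neg: "Re (u * r i) < 0" if "i < degree ?p" for i
    using nz[of "r i"] root[OF that] by force
  then have rnz: "r i \<noteq> 0" if "i < degree ?p" for i using that by force
  have unz: "u \<noteq> 0" using neg[OF deg] by auto
  \<comment> \<open>Gauss-Lucas argument: \<open>u\<close> times a root has negative real part, so
    its negative reciprocal has positive real part. The sum is p'/p at 0, divided by
    \<open>u\<close>.\<close>
  have "0 < (\<Sum>i<degree ?p. Re (- 1 / (u * r i)))"
  proof (rule sum_pos)
    fix i assume "i \<in> {..<degree ?p}"
    then have i: "Re (u * r i) < 0" using neg by auto
    then have "u * r i \<noteq> 0" by force
    then have "(Re (u * r i))\<^sup>2 + (Im (u * r i))\<^sup>2 > 0"
      by (metis complex_neq_0)
    moreover have "Re (- 1 / (u * r i)) = - Re (u * r i) / ((Re (u * r i))\<^sup>2 + (Im (u * r i))\<^sup>2)"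
      by (simp only: Re_divide) simp
    ultimately show "0 < Re (- 1 / (u * r i))" using i by (simp add: divide_neg_pos del: times_complex.sel)
  qed (use deg in auto)
  also have "\<dots> = Re ((\<Sum>i<degree ?p. - 1 / r i) / u)"
    by (simp add: sum_divide_distrib mult.commute)
  finally have "(\<Sum>i<degree ?p. - 1 / r i) \<noteq> 0" by force
  then have "poly (pderiv ?p) 0 \<noteq> 0"
    using poly_pderiv_roots[OF r rnz] p0 by simp
  then show ?case using poly_pderiv_line_poly[of I "cmap C"] snoc.prems(1) by simp
qed

text \<open>On a line of positive direction through a positive point all roots are real and negative, so
  the polynomial is log-concave there and lies below the exponential with the same value and slope.\<close>

lemma mixed_perm_exp_bound:
  fixes y d :: "'b \<Rightarrow> real"
  assumes I: "finite I" "length C \<le> card I" and C: "\<And>c i. c \<in> set C \<Longrightarrow> i \<in> I \<Longrightarrow> 0 < c i" 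
    and y: "\<And>i. i \<in> I \<Longrightarrow> 0 < y i" and d: "\<And>i. i \<in> I \<Longrightarrow> 0 < d i" and "0 \<le> t"
  shows "mixed_perm I C (\<lambda>i. y i + t * d i) 
    \<le> mixed_perm I C y * exp (t * (mixed_perm I (C @ [d]) y / mixed_perm I C y))"
proof -
  let ?p = "line_poly I (cmap C) (\<lambda>i. of_real (y i)) (\<lambda>i. complex_of_real (d i))"
  have nz: "poly ?p t \<noteq> 0" if "Im t \<noteq> 0 \<or> Re t \<ge> 0" for t
  proof -
    \<comment> \<open>As \<open>y\<close> is real, for non-real \<open>t\<close> the sign of
      \<open>Im t\<close> alone puts all points \<open>y i + t * d i\<close> in one half-plane; on
      the nonnegative axis the points are positive.\<close>
    let ?u = "if Im t > 0 then - \<i> else if Im t < 0 then \<i> else 1"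
    have "mixed_perm I (cmap C) (\<lambda>i. of_real (y i) + t * of_real (d i)) \<noteq> 0"
    proof (rule mixed_perm_stable[where u = ?u])
      fix i assume "i \<in> I"
      then have "0 < y i" "0 < d i" using y d by auto
      with that show "0 < Re (?u * (of_real (y i) + t * of_real (d i)))"
        by (auto simp: mult_neg_pos add_pos_nonneg)
    qed (use I C in auto)
    then show ?thesis unfolding poly_line_poly .
  qed
  have ev: "poly ?p (of_real s) = of_real (mixed_perm I C (\<lambda>i. y i + s * d i))" for s
    unfolding poly_line_poly
    using mixed_perm_of_real[of I C "\<lambda>i. y i + s * d i", where 'a = complex] by simp
  have p0: "0 < mixed_perm I C y" by (rule mixed_perm_pos) (use I C y in auto)
  define D where "D = degree ?p"
  obtain r where r: "?p = smult (lead_coeff ?p) (\<Prod>i<D. [:- r i, 1:])"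
    and root: "\<And>i. i < D \<Longrightarrow> poly ?p (r i) = 0"
    unfolding D_def using complex_poly_roots[of ?p] by blast
  define a where "a = lead_coeff ?p"
  note r = r[folded a_def]
  have fact: "poly ?p s = a * (\<Prod>i<D. s - r i)" for s
    by (subst r) (simp add: poly_prod)
  \<comment> \<open>The polynomial equals its value at 0 times the product of the
    \<open>1 + t * s i\<close> with \<open>s i\<close> nonnegative. The sum of the
    \<open>s i\<close> is the logarithmic derivative, and each factor is at most
    \<open>exp (t * s i)\<close>.\<close>
  define s where "s i = - 1 / Re (r i)" for i
  have neg: "Im (r i) = 0 \<and> Re (r i) < 0" if "i < D" for i
    using nz[of "r i"] root[OF that] by force
  then have rnz: "r i \<noteq> 0" if "i < D" for i using that by force
  have rs: "- 1 / r i = of_real (s i)" "s i \<ge> 0" if "i < D" for i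
  proof -
    have "r i = of_real (Re (r i))" using neg[OF that] by (simp add: complex_eq_iff)
    then have "- 1 / r i = - 1 / of_real (Re (r i))" by simp
    then show "- 1 / r i = of_real (s i)" by (simp add: s_def)
    show "s i \<ge> 0" using neg[OF that] by (simp add: s_def divide_nonpos_neg)
  qed
  have "of_real (mixed_perm I (C @ [d]) y) = poly (pderiv ?p) 0"
    using poly_pderiv_line_poly[of I "cmap C"] I 
      mixed_perm_of_real[of I "C @ [d]" y, where 'a = complex] by simp
  also have "\<dots> = poly ?p 0 * (\<Sum>i<D. - 1 / r i)"
    by (rule poly_pderiv_roots[OF r rnz])
  also have "(\<Sum>i<D. - 1 / r i) = of_real (\<Sum>i<D. s i)"
    using rs by simp
  also have "poly ?p 0 = of_real (mixed_perm I C y)" using ev[of 0] by simp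
  finally have "mixed_perm I (C @ [d]) y = mixed_perm I C y * (\<Sum>i<D. s i)"
    unfolding of_real_mult[symmetric] of_real_eq_iff .
  then have q: "mixed_perm I (C @ [d]) y / mixed_perm I C y = (\<Sum>i<D. s i)" using p0 by simp
  have "poly ?p (of_real t) = a * (\<Prod>i<D. of_real t - r i)"
    by (rule fact)
  also have "(\<Prod>i<D. of_real t - r i) = (\<Prod>i<D. - r i * of_real (1 + t * s i))"
  proof (intro prod.cong refl)
    fix i assume "i \<in> {..<D}"
    then have "- 1 / r i = of_real (s i)" "r i \<noteq> 0" using rs rnz by auto
    then show "of_real t - r i = - r i * of_real (1 + t * s i)"
      by (simp add: field_simps flip: \<open>- 1 / r i = of_real (s i)\<close>)
  qed
  also have "a * \<dots> = poly ?p 0 * of_real (\<Prod>i<D. 1 + t * s i)"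
    unfolding fact prod.distrib by simp
  also have "poly ?p 0 = of_real (mixed_perm I C y)" using ev[of 0] by simp
  finally have "mixed_perm I C (\<lambda>i. y i + t * d i) = mixed_perm I C y * (\<Prod>i<D. 1 + t * s i)"
    unfolding ev of_real_mult[symmetric] of_real_eq_iff .
  also have "(\<Prod>i<D. 1 + t * s i) \<le> (\<Prod>i<D. exp (t * s i))"
    using rs \<open>0 \<le> t\<close> by (intro prod_mono) (auto simp: exp_ge_add_one_self)
  also have "\<dots> = exp (t * (\<Sum>i<D. s i))"
    by (simp add: exp_sum sum_distrib_left)
  finally show ?thesis using p0 by (simp add: q)
qed

text \<open>One degree is left, so \<open>mixed_perm I C\<close> is a linear form and its derivative
  in direction \<open>d\<close> is its value at \<open>d\<close>.\<close>

lemma mixed_perm_last: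
  assumes "finite I" "card I = Suc (length C)"
  shows "mixed_perm I (C @ [d]) y = mixed_perm I C d"
  using assms
proof (induction C arbitrary: I)
  case Nil
  then obtain a where "I = {a}" using card_1_singletonE by auto
  then show ?case by simp
next
  case (Cons c C)
  have "mixed_perm (I - {i}) (C @ [d]) y = mixed_perm (I - {i}) C d" if "i \<in> I" for i
    using that Cons.prems by (intro Cons.IH) auto
  then show ?case by simp
qed

text \<open>Gurvits' induction: after differentiation in the first \<open>s\<close> columns the
  polynomial in the remaining variables has capacity at least \<open>K * exp (- s)\<close>. Each
  step trades one variable for a derivative and costs a factor e.\<close>

lemma mixed_perm_capacity_pos:
  fixes C :: "('b \<Rightarrow> real) list"
  defines "n \<equiv> length C"
  assumes I: "finite I" "card I = n" and C: "\<And>c i. c \<in> set C \<Longrightarrow> i \<in> I \<Longrightarrow> 0 < c i" 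
    and n: "0 < n"
    and cap: "\<And>x. (\<And>j. 0 < x j) \<Longrightarrow> K * (\<Prod>j<n. x j) \<le> (\<Prod>i\<in>I. \<Sum>j<n. x j * (C ! j) i)"
    and K: "0 < K"
  shows "K * exp (- real n) \<le> mixed_perm I C y"
proof -
  have Cpos: "0 < (C ! j) i" if "j < n" "i \<in> I" for i j
    using C[of "C ! j" i] that by (simp add: n_def)
  have step: "K * exp (- real s) * (\<Prod>j\<in>{s..<n}. x j) \<le> 
    mixed_perm I (take s C) (\<lambda>i. \<Sum>j\<in>{s..<n}. x j * (C ! j) i)" 
    if "s < n" "\<And>j. 0 < x j" for s x
    using that
  proof (induction s arbitrary: x)
    case 0
    then show ?case using cap[of x] by (simp add: atLeast0LessThan)
  next
    case (Suc s)
    define y where "y i = (\<Sum>j\<in>{Suc s..<n}. x j * (C ! j) i)" for i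
    define M where "M = mixed_perm I (take s C) y"
    define M' where "M' = mixed_perm I (take (Suc s) C) y"
    have takeC: "take (Suc s) C = take s C @ [C ! s]" 
      using Suc.prems by (simp add: take_Suc_conv_app_nth n_def)
    have y: "0 < y i" if "i \<in> I" for i
      unfolding y_def by (rule sum_pos) (use Suc.prems Cpos that in \<open>auto intro!: mult_pos_pos\<close>)
    have take_pos: "0 < c i" if "c \<in> set (take r C)" "i \<in> I" for c i r
      using that C by (meson in_set_takeD)
    have M: "0 < M" unfolding M_def
      by (rule mixed_perm_pos) (use Suc.prems I y take_pos in \<open>auto simp: n_def\<close>)
    have M': "0 < M'" unfolding M'_def
      by (rule mixed_perm_pos) (use Suc.prems I y take_pos in \<open>auto simp: n_def\<close>)
    \<comment> \<open>This value minimises \<open>exp (t * M' / M) / t\<close>, the bound of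
      \<open>mixed_perm_exp_bound\<close> relative to the variable \<open>t\<close>; the exponent
      becomes 1.\<close>
    define t where "t = M / M'"
    have t: "0 < t" using M M' by (simp add: t_def)
    define P where "P = (\<Prod>j\<in>{Suc s..<n}. x j)"
    have split: "{s..<n} = insert s {Suc s..<n}" using Suc.prems by auto
    have "K * exp (- real s) * (t * P) = K * exp (- real s) * (\<Prod>j\<in>{s..<n}. (x(s := t)) j)"
      by (simp add: split P_def)
    also have "\<dots> \<le> mixed_perm I (take s C) (\<lambda>i. \<Sum>j\<in>{s..<n}. (x(s := t)) j * (C ! j) i)"
      using Suc.prems t by (intro Suc.IH) auto
    also have "\<dots> = mixed_perm I (take s C) (\<lambda>i. y i + t * (C ! s) i)"
      by (simp add: split y_def add.commute)
    also have "\<dots> \<le> M * exp (t * (mixed_perm I (take s C @ [C ! s]) y / M))"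
      unfolding M_def
      by (rule mixed_perm_exp_bound) (use Suc.prems I y t take_pos Cpos in \<open>auto simp: n_def\<close>)
    also have "t * (mixed_perm I (take s C @ [C ! s]) y / M) = 1"
      using M M' by (simp add: t_def M'_def takeC)
    finally have "K * exp (- real s) * P \<le> M' * exp 1"
      using M M' by (simp add: t_def field_simps)
    then have "K * (exp (- real s) * exp (- 1)) * P \<le> M'"
      by (simp add: exp_minus field_simps)
    also have "exp (- real s) * exp (- 1) = exp (- real (Suc s))" by (simp flip: exp_add)
    finally show ?case by (simp add: P_def M'_def y_def[abs_def])
  qed
  \<comment> \<open>The last derivative is an evaluation and costs nothing, so the induction stops
    at \<open>n - 1\<close>.\<close>
  have takeC: "C = take (n - 1) C @ [C ! (n - 1)]"
    using n by (metis One_nat_def Suc_pred diff_less lessI n_def take_Suc_conv_app_nth take_all_iff order_refl)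
  have "{n - 1..<n} = {n - 1}" using n by auto
  then have "K * exp (- real (n - 1)) \<le> mixed_perm I (take (n - 1) C) (C ! (n - 1))"
    using step[of "n - 1" "\<lambda>_. 1"] n \<open>{n - 1..<n} = {n - 1}\<close> by simp
  also have "\<dots> = mixed_perm I (take (n - 1) C @ [C ! (n - 1)]) y"
    by (rule mixed_perm_last[symmetric]) (use I n in \<open>auto simp: n_def\<close>)
  also have "\<dots> = mixed_perm I C y" using takeC by simp
  finally have "K * exp (- real (n - 1)) \<le> mixed_perm I C y" .
  moreover have "K * exp (- real n) \<le> K * exp (- real (n - 1))" using K by simp
  ultimately show ?thesis by linarith
qed

text \<open>Zero entries are removed by adding \<epsilon> to the whole matrix, which only enlarges
  the product in the capacity hypothesis, and letting \<epsilon> tend to 0.\<close>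

lemma mixed_perm_capacity:
  fixes C :: "('b \<Rightarrow> real) list"
  defines "n \<equiv> length C"
  assumes I: "finite I" "card I = n" and C: "\<And>c i. c \<in> set C \<Longrightarrow> i \<in> I \<Longrightarrow> 0 \<le> c i" 
    and n: "0 < n"
    and cap: "\<And>x. (\<And>j. 0 < x j) \<Longrightarrow> K * (\<Prod>j<n. x j) \<le> (\<Prod>i\<in>I. \<Sum>j<n. x j * (C ! j) i)"
    and K: "0 < K"
  shows "K * exp (- real n) \<le> mixed_perm I C y"
proof -
  define D where "D \<epsilon> = map (\<lambda>c i. c i + \<epsilon>) C" for \<epsilon> :: real
  have "K * exp (- real n) \<le> mixed_perm I (D \<epsilon>) y" if "0 < \<epsilon>" for \<epsilon>
  proof -
    have len: "length (D \<epsilon>) = n" by (simp add: D_def n_def)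
    show ?thesis
    proof (rule mixed_perm_capacity_pos[of I "D \<epsilon>" K y, unfolded len])
      fix x :: "nat \<Rightarrow> real" assume x: "\<And>j. 0 < x j"
      have "K * (\<Prod>j<n. x j) \<le> (\<Prod>i\<in>I. \<Sum>j<n. x j * (C ! j) i)" by (rule cap[OF x])
      also have "\<dots> \<le> (\<Prod>i\<in>I. \<Sum>j<n. x j * (D \<epsilon> ! j) i)"
        using x that C
        by (intro prod_mono conjI sum_nonneg sum_mono mult_left_mono mult_nonneg_nonneg)
           (auto simp: D_def n_def less_imp_le)
      finally show "K * (\<Prod>j<n. x j) \<le> (\<Prod>i\<in>I. \<Sum>j<n. x j * (D \<epsilon> ! j) i)" .
    next
      fix c i assume "c \<in> set (D \<epsilon>)" "i \<in> I"
      then show "0 < c i" using C that by (auto simp: D_def intro!: add_nonneg_pos)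
    qed (use I n K in auto)
  qed
  then have "eventually (\<lambda>\<epsilon>. K * exp (- real n) \<le> mixed_perm I (D \<epsilon>) y) (at_right 0)"
    by (auto simp: eventually_at_filter)
  moreover have "((\<lambda>\<epsilon>. mixed_perm I (map (\<lambda>c i. c i + \<epsilon>) C) y) \<longlongrightarrow> mixed_perm I (map (\<lambda>c i. c i + 0) C) y) (at_right 0)"
    by (induction C arbitrary: I) (auto intro!: tendsto_eq_intros)
  ultimately show ?thesis unfolding D_def
    by (intro tendsto_lowerbound[where f = "\<lambda>\<epsilon>. mixed_perm I (map (\<lambda>c i. c i + \<epsilon>) C) y"]) auto
qed

section \<open>Capacity of dense 0-1 matrices\<close>

text \<open>Bathtub principle: with coefficients at most \<open>M\<close> and total mass at most
  \<open>M * q\<close>, filling the \<open>q\<close> largest weights is best.\<close>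

lemma sum_sorted_weights_le:
  fixes c w :: "nat \<Rightarrow> real"
  assumes w: "\<And>i j. i \<le> j \<Longrightarrow> j < n \<Longrightarrow> w j \<le> w i" "\<And>i. i < n \<Longrightarrow> 0 \<le> w i"
    and c: "\<And>i. i < n \<Longrightarrow> 0 \<le> c i" "\<And>i. i < n \<Longrightarrow> c i \<le> M"
    and s: "(\<Sum>i<n. c i) \<le> M * real q" and q: "q \<le> n"
  shows "(\<Sum>i<n. c i * w i) \<le> M * (\<Sum>i<q. w i)"
proof (cases "q = n")
  case True
  then show ?thesis using w c
    by (auto simp: sum_distrib_left intro!: sum_mono mult_right_mono)
next
  case False
  then have qn: "q < n" using q by simp
  have split: "(\<Sum>i<n. f i) = (\<Sum>i<q. f i) + (\<Sum>i=q..<n. f i)" for f :: "nat \<Rightarrow> real"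
    using q by (metis atLeast0LessThan le0 sum.atLeastLessThan_concat)
  have "(\<Sum>i<q. (c i - M) * w i) \<le> (\<Sum>i<q. (c i - M) * w q)"
    using w(1)[of _ q] c qn by (intro sum_mono mult_left_mono_neg) auto
  moreover have "(\<Sum>i=q..<n. c i * w i) \<le> (\<Sum>i=q..<n. c i * w q)"
    using w(1)[of q] c by (intro sum_mono mult_left_mono) auto
  ultimately have "(\<Sum>i<n. c i * w i) - M * (\<Sum>i<q. w i) \<le> ((\<Sum>i<n. c i) - M * real q) * w q"
    by (simp add: split sum_distrib_left sum_distrib_right sum_subtractf algebra_simps)
  also have "\<dots> \<le> 0" using s w(2)[OF qn] by (simp add: mult_nonpos_nonneg)
  finally show ?thesis by simp
qed

lemma sum_Abel_le:
  fixes b g h :: "nat \<Rightarrow> real"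
  assumes b: "\<And>i j. i \<le> j \<Longrightarrow> j < n \<Longrightarrow> b j \<le> b i" "\<And>i. i < n \<Longrightarrow> 0 \<le> b i"
    and gh: "\<And>r. r \<le> n \<Longrightarrow> (\<Sum>j<r. g j) \<le> (\<Sum>j<r. h j)"
  shows "(\<Sum>j<n. b j * g j) \<le> (\<Sum>j<n. b j * h j)"
proof -
  have *: "b r * (\<Sum>j<r. h j - g j) \<le> (\<Sum>j<r. b j * (h j - g j))" if "r < n" for r
    using that
  proof (induction r)
    case (Suc r)
    have "b (Suc r) * (\<Sum>j<Suc r. h j - g j) \<le> b r * (\<Sum>j<Suc r. h j - g j)"
      using b(1)[of r "Suc r"] gh[of "Suc r"] Suc.prems
      by (intro mult_right_mono) (auto simp: sum_subtractf)
    also have "\<dots> = b r * (\<Sum>j<r. h j - g j) + b r * (h r - g r)" by (simp add: algebra_simps)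
    also have "\<dots> \<le> (\<Sum>j<Suc r. b j * (h j - g j))" using Suc by simp
    finally show ?case .
  qed simp
  show ?thesis
  proof (cases n)
    case (Suc r)
    have "0 \<le> b r * (\<Sum>j<Suc r. h j - g j)"
      using b(2)[of r] gh[of "Suc r"] Suc by (auto simp: sum_subtractf)
    also have "\<dots> = b r * (\<Sum>j<r. h j - g j) + b r * (h r - g r)" by (simp add: algebra_simps)
    also have "\<dots> \<le> (\<Sum>j<n. b j * (h j - g j))" using *[of r] Suc by simp
    finally show ?thesis by (simp add: algebra_simps sum_subtractf)
  qed simp
qed

text \<open>Among matrices with entries in \<open>[0, 1]\<close> and line sums at most \<open>z\<close>, the bilinear form is
  maximised by the direct sum of an all-ones block of size \<open>z\<close> and \<open>z\<close> times an identity.\<close>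

lemma bilinear_sorted_le:
  fixes Z :: "nat \<Rightarrow> nat \<Rightarrow> real" and w b :: "nat \<Rightarrow> real"
  assumes w: "\<And>i j. i \<le> j \<Longrightarrow> j < n \<Longrightarrow> w j \<le> w i" "\<And>i. i < n \<Longrightarrow> 0 \<le> w i"
    and b: "\<And>i j. i \<le> j \<Longrightarrow> j < n \<Longrightarrow> b j \<le> b i" "\<And>i. i < n \<Longrightarrow> 0 \<le> b i"
    and Z: "\<And>i j. i < n \<Longrightarrow> j < n \<Longrightarrow> 0 \<le> Z i j" "\<And>i j. i < n \<Longrightarrow> j < n \<Longrightarrow> Z i j \<le> 1"
      "\<And>i. i < n \<Longrightarrow> (\<Sum>j<n. Z i j) \<le> real z" "\<And>j. j < n \<Longrightarrow> (\<Sum>i<n. Z i j) \<le> real z"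
    and z: "z \<le> n"
  shows "(\<Sum>i<n. w i * (\<Sum>j<n. Z i j * b j)) \<le> 
    (\<Sum>i<z. w i) * (\<Sum>j<z. b j) + real z * (\<Sum>i=z..<n. w i * b i)"
proof -
  define g where "g j = (\<Sum>i<n. Z i j * w i)" for j
  \<comment> \<open>The counterpart of \<open>g j\<close> for the extremal matrix. Its diagonal
    entries \<open>z\<close> may exceed 1, so the bound is a relaxation.\<close>
  define h where "h j = (if j < z then \<Sum>i<z. w i else real z * w j)" for j
  have split: "(\<Sum>i<n. f i) = (\<Sum>i<z. f i) + (\<Sum>i=z..<n. f i)" for f :: "nat \<Rightarrow> real"
    using z by (metis atLeast0LessThan le0 sum.atLeastLessThan_concat)
  have "(\<Sum>j<n. b j * g j) \<le> (\<Sum>j<n. b j * h j)"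
  proof (rule sum_Abel_le[OF b])
    fix r assume r: "r \<le> n"
    have eq: "(\<Sum>j<r. g j) = (\<Sum>i<n. (\<Sum>j<r. Z i j) * w i)"
      unfolding g_def by (subst sum.swap) (simp add: sum_distrib_right)
    have tot: "(\<Sum>i<n. \<Sum>j<r. Z i j) \<le> real r * real z"
      using r Z(4) sum_bounded_above[of "{..<r}" "\<lambda>j. \<Sum>i<n. Z i j" "real z"]
      by (subst sum.swap) auto
    \<comment> \<open>A row restricted to the first \<open>r\<close> columns has mass at most
      \<open>min r z\<close>: by the entries if \<open>r\<close> is small, by the row sum otherwise.
      The total is at most \<open>r * z\<close>, enough to fill \<open>z\<close> rows in the first
      case and \<open>r\<close> rows in the second.\<close>
    show "(\<Sum>j<r. g j) \<le> (\<Sum>j<r. h j)"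
    proof (cases "r \<le> z")
      case True
      have "(\<Sum>j<r. g j) \<le> real r * (\<Sum>i<z. w i)"
        unfolding eq
      proof (rule sum_sorted_weights_le[OF w _ _ tot z])
        fix i assume i: "i < n"
        show "(\<Sum>j<r. Z i j) \<le> real r"
          using r i Z(2)[of i] sum_bounded_above[of "{..<r}" "Z i" 1] by auto
      qed (use r Z(1) in \<open>auto intro!: sum_nonneg\<close>)
      also have "\<dots> = (\<Sum>j<r. h j)" using True by (simp add: h_def)
      finally show ?thesis .
    next
      case False
      have "(\<Sum>j<r. g j) \<le> real z * (\<Sum>i<r. w i)"
        unfolding eq
      proof (rule sum_sorted_weights_le[OF w _ _ _ r])
        fix i assume i: "i < n"
        have "(\<Sum>j<r. Z i j) \<le> (\<Sum>j<n. Z i j)"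
          using r i Z(1)[of i] by (intro sum_mono2) auto
        then show "(\<Sum>j<r. Z i j) \<le> real z" using Z(3)[OF i] by simp
      qed (use r Z(1) tot in \<open>auto intro!: sum_nonneg simp: mult.commute\<close>)
      also have "(\<Sum>i<r. w i) = (\<Sum>i<z. w i) + (\<Sum>i=z..<r. w i)"
        using False by (metis atLeast0LessThan le0 nat_le_linear sum.atLeastLessThan_concat)
      also have "real z * \<dots> = (\<Sum>j<z. h j) + (\<Sum>j=z..<r. h j)"
        by (simp add: h_def algebra_simps sum_distrib_left)
      also have "\<dots> = (\<Sum>j<r. h j)"
        using False by (metis atLeast0LessThan le0 nat_le_linear sum.atLeastLessThan_concat)
      finally show ?thesis .
    qed
  qed
  also have "(\<Sum>j<n. b j * g j) = (\<Sum>i<n. w i * (\<Sum>j<n. Z i j * b j))"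
    unfolding g_def sum_distrib_left by (subst sum.swap) (simp add: ac_simps)
  also have "(\<Sum>j<n. b j * h j) = (\<Sum>j<z. b j) * (\<Sum>i<z. w i) + (\<Sum>j=z..<n. b j * (real z * w j))"
    by (simp add: split h_def flip: sum_distrib_right)
  also have "(\<Sum>j=z..<n. b j * (real z * w j)) = real z * (\<Sum>i=z..<n. w i * b i)"
    by (simp add: sum_distrib_left ac_simps)
  also have "(\<Sum>j<z. b j) * (\<Sum>i<z. w i) = (\<Sum>i<z. w i) * (\<Sum>j<z. b j)" by (rule mult.commute)
  finally show ?thesis .
qed

text \<open>The concave symmetric core of the capacity estimate: \<open>\<rho>\<close> is the mean of \<open>b\<close>, and the
  right-hand side is the tangent at \<open>\<rho>\<close>.\<close>

lemma ln_tangent_bound: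
  fixes b \<rho> :: real
  assumes b: "0 < b" "b \<le> 1" and \<rho>: "0 < \<rho>" "\<rho> \<le> 1"
  shows "ln \<rho> + ln (1 - b + \<rho>) - ln b \<ge> - ((1 + 1 / \<rho>) * (b - \<rho>))"
proof -
  define g where "g x = ln \<rho> + ln (1 - x + \<rho>) - ln x + (1 + 1 / \<rho>) * (x - \<rho>)" for x
  define g' where "g' x = - 1 / (1 - x + \<rho>) - 1 / x + (1 + 1 / \<rho>)" for x
  have der: "(g has_real_derivative g' x) (at x)" if "0 < x" "x \<le> 1" for x
    unfolding g_def g'_def using that \<rho> by (auto intro!: derivative_eq_intros)
  \<comment> \<open>For \<rho> < 1 the function is not convex near 1, so the minimum at \<rho> is
    read off the derivative: in factored form it never has the sign opposite to
    \<open>x - \<rho>\<close> on (0, 1].\<close>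
  have g': "g' x = (1 + \<rho>) * ((x - \<rho>) * (1 - x)) / (\<rho> * x * (1 - x + \<rho>))" if "0 < x" "x \<le> 1" for x
  proof -
    have "1 - x + \<rho> \<noteq> 0" using that \<rho> by simp
    then show ?thesis using that \<rho> unfolding g'_def by (simp add: divide_simps) algebra
  qed
  have "g \<rho> \<le> g b"
  proof (cases "b \<le> \<rho>")
    case True
    show ?thesis
    proof (rule DERIV_nonpos_imp_nonincreasing[OF True])
      fix x assume "b \<le> x" "x \<le> \<rho>"
      then have x: "0 < x" "x \<le> 1" "x \<le> \<rho>" using b \<rho> by auto
      then have "g' x \<le> 0" unfolding g'[OF x(1,2)] using \<rho>
        by (intro divide_nonpos_nonneg mult_nonneg_nonpos mult_nonpos_nonneg) auto
      with der[OF x(1,2)] show "\<exists>y. (g has_real_derivative y) (at x) \<and> y \<le> 0" by blast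
    qed
  next
    case False
    show ?thesis
    proof (rule DERIV_nonneg_imp_nondecreasing[of \<rho> b])
      fix x assume "\<rho> \<le> x" "x \<le> b"
      then have x: "0 < x" "x \<le> 1" "x \<ge> \<rho>" using b \<rho> by auto
      then have "g' x \<ge> 0" unfolding g'[OF x(1,2)] using \<rho>
        by (intro divide_nonneg_nonneg mult_nonneg_nonneg) auto
      with der[OF x(1,2)] show "\<exists>y. (g has_real_derivative y) (at x) \<and> 0 \<le> y" by blast
    qed (use False in auto)
  qed
  moreover have "g \<rho> = 0" by (simp add: g_def)
  ultimately show ?thesis by (simp add: g_def algebra_simps)
qed

lemma ln_mean_ge:
  fixes b :: "'b \<Rightarrow> real"
  assumes "finite J" "J \<noteq> {}" "\<And>j. j \<in> J \<Longrightarrow> 0 < b j"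
  shows "(\<Sum>j\<in>J. ln (b j)) \<le> real (card J) * ln ((\<Sum>j\<in>J. b j) / real (card J))"
proof -
  define \<rho> where "\<rho> = (\<Sum>j\<in>J. b j) / real (card J)"
  have c: "0 < real (card J)" using assms by (simp add: card_gt_0_iff)
  have \<rho>: "0 < \<rho>" unfolding \<rho>_def using assms c by (intro divide_pos_pos sum_pos) auto
  have "(\<Sum>j\<in>J. ln (b j)) \<le> (\<Sum>j\<in>J. ln \<rho> + (b j / \<rho> - 1))"
  proof (rule sum_mono)
    fix j assume "j \<in> J"
    then have "ln (b j / \<rho>) \<le> b j / \<rho> - 1" using assms \<rho> by (intro ln_le_minus_one) auto
    then show "ln (b j) \<le> ln \<rho> + (b j / \<rho> - 1)" using assms(3)[OF \<open>j \<in> J\<close>] \<rho> by (simp add: ln_divide_pos)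
  qed
  also have "\<dots> = real (card J) * ln \<rho> + ((\<Sum>j\<in>J. b j) / \<rho> - real (card J))"
    by (simp add: sum.distrib sum_subtractf sum_divide_distrib)
  also have "(\<Sum>j\<in>J. b j) / \<rho> = real (card J)" using c sum_pos[of J b] assms by (simp add: \<rho>_def less_imp_neq[symmetric])
  finally show ?thesis by (simp add: \<rho>_def)
qed

text \<open>The capacity inequality for the extremal pattern of zeros, normalised. With \<rho> the
  mean of \<open>b\<close> and \<kappa> = z / d, each logarithm is taken, up to the factor
  \<open>d\<close>, at the convex combination of \<rho> and \<open>1 - b j + \<rho>\<close> with
  weights \<open>1 - \<kappa>\<close> and \<kappa>. Concavity of \<open>ln\<close> splits it: the
  \<kappa> part is \<open>ln_tangent_bound\<close>, whose linear terms cancel in the sum, and the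
  rest is the inequality of means. \<open>z \<le> d\<close> makes \<kappa> a legitimate
  weight.\<close>

lemma ln_interpolation_bound:
  fixes b :: "'b \<Rightarrow> real" and z :: nat and J :: "'b set"
  defines "d \<equiv> card J" and "R \<equiv> \<Sum>j\<in>J. b j"
  assumes J: "finite J" "J \<noteq> {}" and b: "\<And>j. j \<in> J \<Longrightarrow> 0 < b j" "\<And>j. j \<in> J \<Longrightarrow> b j \<le> 1"
    and zd: "z \<le> d"
  shows "real z * ln R + (\<Sum>j\<in>J. ln (real z * (1 - b j) + R)) 
    \<ge> real (z + d) * ln (real d) + (\<Sum>j\<in>J. ln (b j))"
proof -
  define \<rho> where "\<rho> = R / real d"
  define \<kappa> where "\<kappa> = real z / real d"
  have d: "0 < real d" using J by (simp add: card_gt_0_iff d_def)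
  have R: "0 < R" unfolding R_def using J b by (intro sum_pos) auto
  have "R \<le> real d" unfolding R_def d_def using sum_bounded_above[of J b 1] b by simp
  then have \<rho>: "0 < \<rho>" "\<rho> \<le> 1" using R d by (auto simp: \<rho>_def)
  have \<kappa>: "0 \<le> \<kappa>" "\<kappa> \<le> 1" using d zd by (auto simp: \<kappa>_def)
  have "ln (real z * (1 - b j) + R) \<ge> ln (real d) + ln \<rho> + \<kappa> * (ln (b j) - 2 * ln \<rho> - (1 + 1 / \<rho>) * (b j - \<rho>))"
    if j: "j \<in> J" for j
  proof -
    have "concave_on {0<..} (ln :: real \<Rightarrow> real)" by (rule ln_concave)
    then have "(1 - \<kappa>) * ln \<rho> + \<kappa> * ln (1 - b j + \<rho>) \<le> ln ((1 - \<kappa>) *\<^sub>R \<rho> + \<kappa> *\<^sub>R (1 - b j + \<rho>))"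
      using \<kappa> \<rho> b[OF j] by (intro concave_onD) auto
    also have "(1 - \<kappa>) *\<^sub>R \<rho> + \<kappa> *\<^sub>R (1 - b j + \<rho>) = (real z * (1 - b j) + R) / real d"
      using d by (simp add: \<rho>_def \<kappa>_def field_simps)
    also have "ln \<dots> = ln (real z * (1 - b j) + R) - ln (real d)"
      using d b[OF j] R by (intro ln_divide_pos add_nonneg_pos) auto
    finally have 1: "(1 - \<kappa>) * ln \<rho> + \<kappa> * ln (1 - b j + \<rho>) \<le> ln (real z * (1 - b j) + R) - ln (real d)" .
    have "\<kappa> * ln (1 - b j + \<rho>) \<ge> \<kappa> * (ln (b j) - ln \<rho> - (1 + 1 / \<rho>) * (b j - \<rho>))"
      using ln_tangent_bound[OF b(1)[OF j] b(2)[OF j] \<rho>] \<kappa> by (intro mult_left_mono) auto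
    with 1 show ?thesis by (simp add: algebra_simps)
  qed
  then have "(\<Sum>j\<in>J. ln (real z * (1 - b j) + R)) \<ge> 
    (\<Sum>j\<in>J. ln (real d) + ln \<rho> + \<kappa> * (ln (b j) - 2 * ln \<rho> - (1 + 1 / \<rho>) * (b j - \<rho>)))"
    by (rule sum_mono)
  also have "(\<Sum>j\<in>J. ln (real d) + ln \<rho> + \<kappa> * (ln (b j) - 2 * ln \<rho> - (1 + 1 / \<rho>) * (b j - \<rho>)))
    = real d * ln (real d) + real d * ln \<rho> + \<kappa> * ((\<Sum>j\<in>J. ln (b j)) - 2 * real d * ln \<rho> - (1 + 1 / \<rho>) * (R - real d * \<rho>))"
    by (simp add: sum.distrib sum_subtractf R_def d_def distrib_left flip: sum_distrib_left)
  also have "R - real d * \<rho> = 0" using d by (simp add: \<rho>_def)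
  finally have 2: "(\<Sum>j\<in>J. ln (real z * (1 - b j) + R)) \<ge> real d * ln (real d) + real d * ln \<rho> 
    + \<kappa> * ((\<Sum>j\<in>J. ln (b j)) - 2 * real d * ln \<rho>)" by simp
  have "(1 - \<kappa>) * (\<Sum>j\<in>J. ln (b j)) \<le> (1 - \<kappa>) * (real d * ln \<rho>)"
    using ln_mean_ge[OF J b(1)] \<kappa> by (intro mult_left_mono) (auto simp: R_def d_def \<rho>_def)
  moreover have "real z * ln R = \<kappa> * (real d * ln \<rho>) + real z * ln (real d)"
    using d R by (simp add: \<kappa>_def \<rho>_def ln_div field_simps)
  ultimately show ?thesis using 2 by (simp add: algebra_simps)
qed

text \<open>Replacing the weights \<open>u\<close> of the zeros in each row by those
  \<open>v\<close> of the extremal pattern can only decrease the product, by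
  \<open>bilinear_sorted_le\<close>; \<open>ln_interpolation_bound\<close> then settles the extremal
  pattern.\<close>

lemma capacity_sorted:
  fixes Z :: "nat \<Rightarrow> nat \<Rightarrow> real" and b :: "nat \<Rightarrow> real"
  assumes b: "\<And>i j. i \<le> j \<Longrightarrow> j < n \<Longrightarrow> b j \<le> b i" "\<And>i. i < n \<Longrightarrow> 0 < b i"
    and Z: "\<And>i j. i < n \<Longrightarrow> j < n \<Longrightarrow> 0 \<le> Z i j" "\<And>i j. i < n \<Longrightarrow> j < n \<Longrightarrow> Z i j \<le> 1"
      "\<And>i. i < n \<Longrightarrow> (\<Sum>j<n. Z i j) \<le> real z" "\<And>j. j < n \<Longrightarrow> (\<Sum>i<n. Z i j) \<le> real z"
    and z: "1 \<le> z" "2 * z \<le> n"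
    and u: "\<And>i. i < n \<Longrightarrow> u i = (\<Sum>j<n. Z i j * b j)"
      "\<And>i j. i \<le> j \<Longrightarrow> j < n \<Longrightarrow> u j \<le> u i"
  shows "real (n - z) ^ n * (\<Prod>j<n. b j) \<le> (\<Prod>i<n. (\<Sum>j<n. b j) - u i)"
proof -
  define T where "T = (\<Sum>j<z. b j)"
  define R where "R = (\<Sum>j=z..<n. b j)"
  define B where "B = (\<Sum>j<n. b j)"
  define v where "v i = (if i < z then T else real z * b i)" for i
  have split: "(\<Sum>i<n. f i) = (\<Sum>i<z. f i) + (\<Sum>i=z..<n. f i)" for f :: "nat \<Rightarrow> real"
    using z by (metis add_leD1 atLeast0LessThan le0 mult_2 sum.atLeastLessThan_concat)
  have B: "B = T + R" unfolding B_def T_def R_def by (rule split)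
  have "0 \<in> {..<z}" using z by simp
  then have ne: "{..<z} \<noteq> {}" by blast
  have T: "0 < T" unfolding T_def using b z by (intro sum_pos ne) auto
  have R: "0 < R" unfolding R_def using b z by (intro sum_pos) auto
  have zb: "real z * b i \<le> T" if "z \<le> i" "i < n" for i
    unfolding T_def using sum_bounded_below[of "{..<z}" "b i" b] b(1)[of _ i] that by auto
  have vB: "v i < B" if "i < n" for i using zb[of i] that R by (auto simp: v_def B)
  have uB: "u i < B" if i: "i < n" for i
  proof -
    have "u i \<le> T"
      using sum_sorted_weights_le[of n b "Z i" 1 z] b Z(1-3)[OF i] i z 
      by (simp add: u(1)[OF i] T_def less_imp_le)
    then show ?thesis using R B by simp
  qed
  \<comment> \<open>The slope of \<open>ln\<close> at \<open>B - u i\<close>: concavity turns the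
    comparison of products into one of linear forms in \<open>u\<close> and \<open>v\<close>. It is
    sorted because \<open>u\<close> is.\<close>
  define w where "w i = 1 / (B - u i)" for i
  have w: "w j \<le> w i" if "i \<le> j" "j < n" for i j
    unfolding w_def using uB[of i] uB[of j] u(2)[OF that] that by (intro divide_left_mono) auto
  have w0: "0 \<le> w i" if "i < n" for i unfolding w_def using uB[OF that] by simp
  have "(\<Sum>i<n. w i * u i) = (\<Sum>i<n. w i * (\<Sum>j<n. Z i j * b j))" using u by simp
  also have "\<dots> \<le> (\<Sum>i<z. w i) * (\<Sum>j<z. b j) + real z * (\<Sum>i=z..<n. w i * b i)"
    by (rule bilinear_sorted_le) (use w w0 b Z z in \<open>auto intro: less_imp_le\<close>)
  also have "\<dots> = (\<Sum>i<n. w i * v i)"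
    by (simp add: split v_def T_def sum_distrib_left sum_distrib_right ac_simps)
  finally have wuv: "(\<Sum>i<n. w i * u i) \<le> (\<Sum>i<n. w i * v i)" .
  have "(\<Sum>i<n. ln (B - v i)) \<le> (\<Sum>i<n. ln (B - u i) + (w i * u i - w i * v i))"
  proof (rule sum_mono)
    fix i assume "i \<in> {..<n}"
    then have i: "u i < B" "v i < B" using uB vB by auto
    have "ln ((B - v i) / (B - u i)) \<le> (B - v i) / (B - u i) - 1"
      using i by (intro ln_le_minus_one) auto
    also have "\<dots> = w i * u i - w i * v i" using i by (simp add: w_def divide_simps)
    finally show "ln (B - v i) \<le> ln (B - u i) + (w i * u i - w i * v i)"
      using i by (simp add: ln_div)
  qed
  also have "\<dots> \<le> (\<Sum>i<n. ln (B - u i))" using wuv by (simp add: sum.distrib sum_subtractf)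
  finally have uv: "(\<Sum>i<n. ln (B - v i)) \<le> (\<Sum>i<n. ln (B - u i))" .
  \<comment> \<open>The mean of the \<open>z\<close> largest values of \<open>b\<close>. Division by
    it brings the other values to at most 1, as \<open>ln_interpolation_bound\<close> requires, and
    the product of the \<open>z\<close> largest is at most \<open>t ^ z\<close> by the inequality of
    means.\<close>
  define t where "t = T / real z"
  have t: "0 < t" using T z by (simp add: t_def)
  have Tt: "T = real z * t" using z by (simp add: t_def)
  have "real z * ln (\<Sum>j\<in>{z..<n}. b j / t) + (\<Sum>j\<in>{z..<n}. ln (real z * (1 - b j / t) + (\<Sum>j\<in>{z..<n}. b j / t))) 
    \<ge> real (z + card {z..<n}) * ln (real (card {z..<n})) + (\<Sum>j\<in>{z..<n}. ln (b j / t))"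
    using z b t zb by (intro ln_interpolation_bound) (auto simp: t_def field_simps)
  moreover have "(\<Sum>j\<in>{z..<n}. b j / t) = R / t" by (simp add: R_def sum_divide_distrib)
  moreover have "(\<Sum>j\<in>{z..<n}. ln (real z * (1 - b j / t) + R / t)) = (\<Sum>j\<in>{z..<n}. ln (B - v j) - ln t)"
  proof (intro sum.cong refl)
    fix j assume j: "j \<in> {z..<n}"
    have "real z * (1 - b j / t) + R / t = (B - v j) / t"
      using j t by (simp add: B Tt v_def field_simps)
    then show "ln (real z * (1 - b j / t) + R / t) = ln (B - v j) - ln t"
      using t vB[of j] j by (simp add: ln_div)
  qed
  moreover have "(\<Sum>j\<in>{z..<n}. ln (b j / t)) = (\<Sum>j\<in>{z..<n}. ln (b j) - ln t)"
    using t b by (intro sum.cong refl ln_divide_pos) auto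
  ultimately have "real z * (ln R - ln t) + (\<Sum>j\<in>{z..<n}. ln (B - v j)) 
    \<ge> real n * ln (real (n - z)) + (\<Sum>j\<in>{z..<n}. ln (b j))"
    using t R z by (simp add: ln_div sum_subtractf)
  moreover have "(\<Sum>j<z. ln (b j)) \<le> real z * ln t"
    using ln_mean_ge[OF finite_lessThan ne, of b] z b by (auto simp: t_def T_def)
  moreover have "(\<Sum>j<z. ln (B - v j)) = real z * ln R" by (simp add: v_def B)
  ultimately have "real n * ln (real (n - z)) + (\<Sum>j<n. ln (b j)) \<le> (\<Sum>i<n. ln (B - v i))"
    by (simp add: split algebra_simps)
  also note uv
  finally have "real n * ln (real (n - z)) + (\<Sum>j<n. ln (b j)) \<le> (\<Sum>i<n. ln (B - u i))" .
  moreover have "ln (real (n - z) ^ n * (\<Prod>j<n. b j)) = real n * ln (real (n - z)) + (\<Sum>j<n. ln (b j))"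
  proof -
    have "ln (\<Prod>j<n. b j) = (\<Sum>j<n. ln (b j))" using b(2) by (intro ln_prod) (auto simp: less_imp_neq[symmetric])
    moreover have "0 < (\<Prod>j<n. b j)" using b(2) by (intro prod_pos) auto
    ultimately show ?thesis using z by (simp add: ln_mult_pos ln_realpow)
  qed
  moreover have "ln (\<Prod>i<n. B - u i) = (\<Sum>i<n. ln (B - u i))" using uB by (intro ln_prod) auto
  moreover have "0 < (\<Prod>i<n. B - u i)" using uB by (intro prod_pos) auto
  moreover have "0 < real (n - z) ^ n * (\<Prod>j<n. b j)"
    using z b by (intro mult_pos_pos prod_pos) auto
  ultimately show ?thesis by (simp add: B_def ln_le_cancel_iff[symmetric] del: ln_le_cancel_iff)
qed

lemma obtain_antimono_enum:
  fixes g :: "'b \<Rightarrow> real"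
  assumes "finite A"
  obtains f where "bij_betw f {..<card A} A" "\<And>i j. i \<le> j \<Longrightarrow> j < card A \<Longrightarrow> g (f j) \<le> g (f i)"
proof -
  obtain xs where xs: "set xs = A" "distinct xs" using finite_distinct_list[OF assms] by blast
  define ys where "ys = sort_key (\<lambda>a. - g a) xs"
  have ys: "set ys = A" "distinct ys" "sorted (map (\<lambda>a. - g a) ys)" using xs by (auto simp: ys_def)
  then have len: "length ys = card A" by (metis distinct_card)
  show ?thesis
  proof (rule that[of "\<lambda>i. ys ! i"])
    show "bij_betw ((!) ys) {..<card A} A" using ys len by (intro bij_betw_nth) auto
    show "g (ys ! j) \<le> g (ys ! i)" if "i \<le> j" "j < card A" for i j
      using sorted_nth_mono[OF ys(3), of i j] that len by simp
  qed
qed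

text \<open>Neither side changes under permutations of rows and columns, so columns are sorted by
  \<open>x\<close> and rows by the weight \<open>u\<close> of their zeros;
  \<open>capacity_sorted\<close> then applies to the indicator of the zeros.\<close>

lemma zero_one_matrix_capacity:
  fixes C :: "('b \<Rightarrow> real) list" and x :: "nat \<Rightarrow> real"
  assumes X: "finite X" "card X = n" and len: "length C = n"
    and C: "\<And>j i. j < n \<Longrightarrow> i \<in> X \<Longrightarrow> (C ! j) i \<in> {0, 1}"
    and row: "\<And>i. i \<in> X \<Longrightarrow> card {j. j < n \<and> (C ! j) i = 0} \<le> z"
    and col: "\<And>j. j < n \<Longrightarrow> card {i\<in>X. (C ! j) i = 0} \<le> z"
    and z: "1 \<le> z" "2 * z \<le> n" and x: "\<And>j. 0 < x j"
  shows "real (n - z) ^ n * (\<Prod>j<n. x j) \<le> (\<Prod>i\<in>X. \<Sum>j<n. x j * (C ! j) i)"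
proof -
  define u where "u i = (\<Sum>j<n. x j * (1 - (C ! j) i))" for i
  obtain \<sigma> where \<sigma>: "bij_betw \<sigma> {..<n} {..<n}" "\<And>i j. i \<le> j \<Longrightarrow> j < n \<Longrightarrow> x (\<sigma> j) \<le> x (\<sigma> i)"
    using obtain_antimono_enum[of "{..<n}" x] by auto
  obtain \<tau> where \<tau>: "bij_betw \<tau> {..<n} X" "\<And>i j. i \<le> j \<Longrightarrow> j < n \<Longrightarrow> u (\<tau> j) \<le> u (\<tau> i)"
    using obtain_antimono_enum[OF X(1), of u] X(2) by auto
  have \<sigma>n: "\<sigma> j < n" if "j < n" for j using \<sigma>(1) that by (auto dest: bij_betwE)
  have \<tau>X: "\<tau> i \<in> X" if "i < n" for i using \<tau>(1) that by (auto dest: bij_betwE)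
  have re\<sigma>: "(\<Sum>j<n. f (\<sigma> j)) = (\<Sum>j<n. f j)" for f :: "nat \<Rightarrow> real"
    by (rule sum.reindex_bij_betw[OF \<sigma>(1)])
  have re\<tau>: "(\<Sum>i<n. f (\<tau> i)) = (\<Sum>i\<in>X. f i)" for f :: "'b \<Rightarrow> real"
    by (rule sum.reindex_bij_betw[OF \<tau>(1)])
  have eq01: "1 - (C ! j) i = (if (C ! j) i = 0 then 1 else 0)" if "j < n" "i \<in> X" for i j
    using C[OF that] by auto
  have "real (n - z) ^ n * (\<Prod>j<n. x (\<sigma> j)) \<le> (\<Prod>i<n. (\<Sum>j<n. x (\<sigma> j)) - u (\<tau> i))"
  proof (rule capacity_sorted[where Z = "\<lambda>i j. 1 - (C ! \<sigma> j) (\<tau> i)" and z = z])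
    fix i assume i: "i < n"
    have "(\<Sum>j<n. 1 - (C ! \<sigma> j) (\<tau> i)) = (\<Sum>j<n. 1 - (C ! j) (\<tau> i))"
      by (rule re\<sigma>)
    also have "\<dots> = (\<Sum>j<n. if (C ! j) (\<tau> i) = 0 then 1 else 0)"
      using eq01 \<tau>X[OF i] by (intro sum.cong) auto
    also have "\<dots> = real (card {j. j < n \<and> (C ! j) (\<tau> i) = 0})"
      by (simp add: sum.If_cases Int_def)
    finally show "(\<Sum>j<n. 1 - (C ! \<sigma> j) (\<tau> i)) \<le> real z" using row[OF \<tau>X[OF i]] by simp
  next
    fix j assume j: "j < n"
    have "(\<Sum>i<n. 1 - (C ! \<sigma> j) (\<tau> i)) = (\<Sum>i\<in>X. 1 - (C ! \<sigma> j) i)"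
      by (rule re\<tau>)
    also have "\<dots> = (\<Sum>i\<in>X. if (C ! \<sigma> j) i = 0 then 1 else 0)"
      using eq01 \<sigma>n[OF j] by (intro sum.cong) auto
    also have "\<dots> = real (card {i\<in>X. (C ! \<sigma> j) i = 0})"
      using X(1) by (simp add: sum.If_cases Int_def)
    finally show "(\<Sum>i<n. 1 - (C ! \<sigma> j) (\<tau> i)) \<le> real z" using col[OF \<sigma>n[OF j]] by simp
  next
    fix i assume i: "i < n"
    show "u (\<tau> i) = (\<Sum>j<n. (1 - (C ! \<sigma> j) (\<tau> i)) * x (\<sigma> j))"
      unfolding u_def by (subst re\<sigma>[symmetric]) (simp add: mult.commute)
  next
    fix i j assume "i < n" "j < n"
    then have "(C ! \<sigma> j) (\<tau> i) \<in> {0, 1}" using C \<sigma>n \<tau>X by blast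
    then show "0 \<le> 1 - (C ! \<sigma> j) (\<tau> i)" "1 - (C ! \<sigma> j) (\<tau> i) \<le> 1" by auto
  qed (use x z \<sigma> \<tau> in auto)
  also have "(\<Prod>j<n. x (\<sigma> j)) = (\<Prod>j<n. x j)" by (rule prod.reindex_bij_betw[OF \<sigma>(1)])
  also have "(\<Prod>i<n. (\<Sum>j<n. x (\<sigma> j)) - u (\<tau> i)) = (\<Prod>i\<in>X. (\<Sum>j<n. x j) - u i)"
    unfolding re\<sigma> by (rule prod.reindex_bij_betw[OF \<tau>(1)])
  also have "\<dots> = (\<Prod>i\<in>X. \<Sum>j<n. x j * (C ! j) i)"
    by (simp add: u_def sum_subtractf algebra_simps)
  finally show ?thesis .
qed

section \<open>Large deviations for random orders\<close>

abbreviation list_swap :: "'a list \<Rightarrow> nat \<Rightarrow> nat \<Rightarrow> 'a list" where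
  "list_swap ys a b \<equiv> ys[a := ys ! b, b := ys ! a]"

lemma list_swap_involutive:
  "a < length ys \<Longrightarrow> b < length ys \<Longrightarrow> list_swap (list_swap ys a b) a b = ys"
  by (rule nth_equalityI) (auto simp: nth_list_update)

lemma list_swap_in_permutations:
  assumes "ys \<in> permutations_of_set V" "a < card V" "b < card V"
  shows "list_swap ys a b \<in> permutations_of_set V"
  using assms length_finite_permutations_of_set[OF assms(1)]
  by (auto simp: permutations_of_set_def distinct_swap)

text \<open>Conditional probability by counting: given an event \<open>F\<close> determined by the
  positions in \<open>P\<close>, the entry at \<open>p\<close> is exchangeable with that at any
  \<open>r\<close> outside \<open>P\<close>. The swap is injective on pairs of an order and an
  \<open>r\<close>; \<open>r = p\<close> is included and changes nothing.\<close>

lemma card_switch_bound: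
  fixes V :: "'a set"
  defines "\<Omega> \<equiv> permutations_of_set V" and "n \<equiv> card V"
  assumes P: "P \<subseteq> {..<n}" and p: "p < n" "p \<notin> P"
    and F: "\<And>ys ys'. ys \<in> \<Omega> \<Longrightarrow> ys' \<in> \<Omega> \<Longrightarrow> (\<And>r. r \<in> P \<Longrightarrow> ys ! r = ys' ! r) \<Longrightarrow> F ys \<Longrightarrow> F ys'"
    and few: "\<And>ys. ys \<in> \<Omega> \<Longrightarrow> card {r \<in> {..<n} - P. B (list_swap ys p r)} \<le> D"
  shows "card {ys \<in> \<Omega>. F ys \<and> B ys} * (n - card P) \<le> card {ys \<in> \<Omega>. F ys} * D"
proof -
  let ?L = "{ys \<in> \<Omega>. F ys \<and> B ys} \<times> ({..<n} - P)"
  let ?R = "SIGMA ys:{ys \<in> \<Omega>. F ys}. {r \<in> {..<n} - P. B (list_swap ys p r)}"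
  let ?f = "\<lambda>(ys, r). (list_swap ys p r, r)"
  have len: "length ys = n" if "ys \<in> \<Omega>" for ys
    using that unfolding \<Omega>_def n_def by (rule length_finite_permutations_of_set)
  have fin: "finite \<Omega>" by (simp add: \<Omega>_def)
  have "inj_on ?f ?L"
  proof (rule inj_onI)
    fix a b assume "a \<in> ?L" "b \<in> ?L" "?f a = ?f b"
    then obtain ys ys' r where *: "a = (ys, r)" "b = (ys', r)" "ys \<in> \<Omega>" "ys' \<in> \<Omega>" "r < n" 
      "list_swap ys p r = list_swap ys' p r" by auto
    then show "a = b" using list_swap_involutive[of p ys r] list_swap_involutive[of p ys' r] p len by metis
  qed
  moreover have "?f ` ?L \<subseteq> ?R"
  proof (rule image_subsetI)
    fix a assume "a \<in> ?L"
    then obtain ys r where a: "a = (ys, r)" and *: "ys \<in> \<Omega>" "F ys" "B ys" "r < n" "r \<notin> P" by auto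
    have in\<Omega>: "list_swap ys p r \<in> \<Omega>" using * p list_swap_in_permutations unfolding \<Omega>_def n_def by blast
    moreover have "F (list_swap ys p r)"
    proof (rule F[OF *(1) in\<Omega> _ *(2)])
      fix q assume "q \<in> P"
      then have "q \<noteq> p" "q \<noteq> r" using p * by auto
      then show "ys ! q = list_swap ys p r ! q" by simp
    qed
    moreover have "B (list_swap (list_swap ys p r) p r)"
      using * p list_swap_involutive[of p ys r] len by metis
    ultimately show "?f a \<in> ?R" using * by (simp add: a)
  qed
  ultimately have "card ?L \<le> card ?R"
    using fin by (intro card_inj_on_le[of ?f]) auto
  also have "card ?R = (\<Sum>ys\<in>{ys \<in> \<Omega>. F ys}. card {r \<in> {..<n} - P. B (list_swap ys p r)})"
    using fin by (intro card_SigmaI) auto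
  also have "\<dots> \<le> card {ys \<in> \<Omega>. F ys} * D"
    using sum_bounded_above[of "{ys \<in> \<Omega>. F ys}" "\<lambda>ys. card {r \<in> {..<n} - P. B (list_swap ys p r)}" D] few by simp
  also have "card ?L = card {ys \<in> \<Omega>. F ys \<and> B ys} * (n - card P)"
    using P by (simp add: card_cartesian_product card_Diff_subset finite_subset)
  finally show ?thesis .
qed

text \<open>The members of \<open>Q\<close> are revealed in increasing order. Each brings a position
  \<open>p i\<close> absent from all earlier sets; with these and the rest of \<open>S i\<close>
  fixed, at most \<open>D\<close> of at least \<open>n - k * q\<close> candidates for
  \<open>p i\<close> give a non-edge.\<close>

lemma card_all_nonedges_le:
  fixes V :: "'a set" and S :: "nat \<Rightarrow> nat set"
  defines "\<Omega> \<equiv> permutations_of_set V" and "n \<equiv> card V"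
  assumes V: "finite V" 
    and D: "\<And>A. A \<subseteq> V \<Longrightarrow> card A = k - 1 \<Longrightarrow> card {v\<in>V. insert v A \<notin> E} \<le> D"
    and S: "\<And>i. i < M \<Longrightarrow> S i \<subseteq> {..<n}" "\<And>i. i < M \<Longrightarrow> card (S i) = k"
    and p: "\<And>i. i < M \<Longrightarrow> p i \<in> S i" "\<And>i i'. i' < i \<Longrightarrow> i < M \<Longrightarrow> p i \<notin> S i'"
    and Q: "Q \<subseteq> {..<M}" "card Q \<le> q"
  shows "card {ys\<in>\<Omega>. \<forall>i\<in>Q. (!) ys ` S i \<notin> E} * (n - k * q) ^ card Q \<le> D ^ card Q * fact n"
proof -
  have len: "length ys = n" if "ys \<in> \<Omega>" for ys
    using that unfolding \<Omega>_def n_def by (rule length_finite_permutations_of_set)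
  have "finite Q" using Q finite_subset by blast
  then show ?thesis using Q
  proof (induction Q rule: finite_linorder_max_induct)
    case empty
    then show ?case using V by (simp add: \<Omega>_def n_def)
  next
    case (insert b A)
    have b: "b < M" using insert by auto
    have cA: "card (insert b A) = Suc (card A)" using insert by auto
    define P where "P = (\<Union>i\<in>A. S i) \<union> (S b - {p b})"
    have Psub: "P \<subseteq> {..<n}" using S insert.prems by (auto simp: P_def)
    have "card P \<le> card (\<Union>i\<in>A. S i) + card (S b - {p b})" unfolding P_def by (rule card_Un_le)
    also have "card (\<Union>i\<in>A. S i) \<le> (\<Sum>i\<in>A. card (S i))" by (rule card_UN_le[OF insert(1)])
    also have "(\<Sum>i\<in>A. card (S i)) = (\<Sum>i\<in>A. k)" using S(2) insert.prems by (intro sum.cong) auto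
    also have "\<dots> = k * card A" by simp
    also have "card (S b - {p b}) \<le> k" using S(2)[OF b] by (metis card.infinite card_Diff1_le le0 order_trans order_refl)
    finally have "card P \<le> k * card (insert b A)" by (simp add: cA)
    also have "\<dots> \<le> k * q" using insert.prems by simp
    finally have cP: "n - k * q \<le> n - card P" by simp
    have pb: "p b \<notin> P" "p b < n"
      using p S(1)[OF b] b insert.hyps by (auto simp: P_def)
    have "card {ys\<in>\<Omega>. (\<forall>i\<in>A. (!) ys ` S i \<notin> E) \<and> (!) ys ` S b \<notin> E} * (n - card P)
      \<le> card {ys\<in>\<Omega>. \<forall>i\<in>A. (!) ys ` S i \<notin> E} * D"
      unfolding \<Omega>_def n_def
    proof (rule card_switch_bound[where p = "p b"])
      show "P \<subseteq> {..<card V}" "p b < card V" "p b \<notin> P" using Psub pb by (auto simp: n_def)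
    next
      fix ys ys' assume *: "\<And>r. r \<in> P \<Longrightarrow> ys ! r = ys' ! r" and **: "\<forall>i\<in>A. (!) ys ` S i \<notin> E"
      have "(!) ys' ` S i = (!) ys ` S i" if "i \<in> A" for i
        using that by (intro image_cong refl *[symmetric]) (auto simp: P_def)
      with ** show "\<forall>i\<in>A. (!) ys' ` S i \<notin> E" by simp
    next
      fix ys assume ys: "ys \<in> permutations_of_set V"
      then have dist: "distinct ys" and set: "set ys = V" by (auto simp: permutations_of_set_def)
      have len: "length ys = n" using len ys by (simp add: \<Omega>_def)
      define B where "B = (!) ys ` (S b - {p b})"
      have Sb: "S b \<subseteq> {..<n}" "finite (S b)" using S(1)[OF b] finite_subset by auto
      have "card B = k - 1" unfolding B_def using Sb len dist p(1)[OF b] S(2)[OF b]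
        by (subst card_image) (auto intro!: inj_on_nth simp: card_Diff_singleton)
      moreover have "B \<subseteq> V" using Sb len set by (auto simp: B_def)
      ultimately have "card {v\<in>V. insert v B \<notin> E} \<le> D" by (intro D)
      \<comment> \<open>Distinct \<open>r\<close> put distinct vertices at \<open>p b\<close>, so
        the bad choices inject into the non-neighbours of \<open>B\<close>.\<close>
      have "(!) ys ` {r \<in> {..<card V} - P. (!) (list_swap ys (p b) r) ` S b \<notin> E} \<subseteq> {v\<in>V. insert v B \<notin> E}"
      proof clarify
        fix r assume r: "r < card V" "r \<notin> P" "(!) (list_swap ys (p b) r) ` S b \<notin> E"
        have sw: "list_swap ys (p b) r ! p b = ys ! r"
          using pb len r by (simp add: nth_list_update n_def)
        have "(!) (list_swap ys (p b) r) ` S b = (!) (list_swap ys (p b) r) ` insert (p b) (S b - {p b})"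
          using p(1)[OF b] by (simp add: insert_absorb)
        also have "\<dots> = insert (ys ! r) ((!) (list_swap ys (p b) r) ` (S b - {p b}))"
          unfolding image_insert sw ..
        also have "(!) (list_swap ys (p b) r) ` (S b - {p b}) = B"
          unfolding B_def
        proof (intro image_cong refl)
          fix x assume "x \<in> S b - {p b}"
          then have "x \<noteq> p b" "x \<noteq> r" using r by (auto simp: P_def)
          then show "list_swap ys (p b) r ! x = ys ! x" by simp
        qed
        finally show "ys ! r \<in> V \<and> insert (ys ! r) B \<notin> E" using r len set by (auto simp: n_def)
      qed
      then have "card ((!) ys ` {r \<in> {..<card V} - P. (!) (list_swap ys (p b) r) ` S b \<notin> E}) \<le> card {v\<in>V. insert v B \<notin> E}"
        using V by (intro card_mono) auto
      moreover have "card ((!) ys ` {r \<in> {..<card V} - P. (!) (list_swap ys (p b) r) ` S b \<notin> E}) = 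
          card {r \<in> {..<card V} - P. (!) (list_swap ys (p b) r) ` S b \<notin> E}"
        using dist len by (intro card_image) (auto simp: inj_on_def nth_eq_iff_index_eq n_def)
      ultimately show "card {r \<in> {..<card V} - P. (!) (list_swap ys (p b) r) ` S b \<notin> E} \<le> D"
        using \<open>card {v\<in>V. insert v B \<notin> E} \<le> D\<close> by linarith
    qed
    then have "card {ys\<in>\<Omega>. \<forall>i\<in>insert b A. (!) ys ` S i \<notin> E} * (n - k * q)
      \<le> card {ys\<in>\<Omega>. \<forall>i\<in>A. (!) ys ` S i \<notin> E} * D"
      using order_trans[OF mult_le_mono2[OF cP]] by (simp add: conj_commute)
    then have "card {ys\<in>\<Omega>. \<forall>i\<in>insert b A. (!) ys ` S i \<notin> E} * (n - k * q) * (n - k * q) ^ card A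
      \<le> card {ys\<in>\<Omega>. \<forall>i\<in>A. (!) ys ` S i \<notin> E} * D * (n - k * q) ^ card A" by (rule mult_le_mono1)
    also have "\<dots> \<le> D * (D ^ card A * fact n)"
      using mult_le_mono2[OF insert.IH, of D] insert.prems cA by (simp add: ac_simps)
    finally show ?case by (simp add: cA ac_simps)
  qed
qed

lemma power_diff_le_binomial:
  assumes "q \<le> s"
  shows "(s - q) ^ q \<le> fact q * (s choose q)"
  using assms
proof (induction q)
  case (Suc q)
  have "(s - Suc q) ^ Suc q \<le> (s - q) * (s - q) ^ q"
    by (simp add: mult_le_mono power_mono)
  also have "\<dots> \<le> (s - q) * (fact q * (s choose q))" using Suc by simp
  also have "\<dots> = fact q * (Suc q * (s choose Suc q))"
    using binomial_absorb_comp[of s q] binomial_absorption[of q s] by (metis mult.left_commute)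
  finally show ?case by (simp add: algebra_simps)
qed simp

text \<open>Moment method: an order with at least \<open>s\<close> non-edges has at least
  \<open>s choose q\<close> sets of \<open>q\<close> non-edges, each covered by
  \<open>card_all_nonedges_le\<close>. A small \<open>q\<close> keeps the \<open>k * q\<close>
  revealed positions few and \<open>s - q\<close> close to \<open>s\<close>.\<close>

lemma card_many_nonedges_le:
  fixes V :: "'a set" and S :: "nat \<Rightarrow> nat set"
  defines "\<Omega> \<equiv> permutations_of_set V" and "n \<equiv> card V"
  assumes V: "finite V" 
    and D: "\<And>A. A \<subseteq> V \<Longrightarrow> card A = k - 1 \<Longrightarrow> card {v\<in>V. insert v A \<notin> E} \<le> D"
    and S: "\<And>i. i < M \<Longrightarrow> S i \<subseteq> {..<n}" "\<And>i. i < M \<Longrightarrow> card (S i) = k"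
    and p: "\<And>i. i < M \<Longrightarrow> p i \<in> S i" "\<And>i i'. i' < i \<Longrightarrow> i < M \<Longrightarrow> p i \<notin> S i'"
    and q: "q \<le> s"
  shows "card {ys\<in>\<Omega>. s \<le> card {i. i < M \<and> (!) ys ` S i \<notin> E}} * ((s - q) * (n - k * q)) ^ q \<le> (M * D) ^ q * fact n"
proof -
  let ?bad = "\<lambda>ys. {i. i < M \<and> (!) ys ` S i \<notin> E}"
  let ?T = "{ys\<in>\<Omega>. s \<le> card (?bad ys)}"
  let ?QQ = "{Q. Q \<subseteq> {..<M} \<and> card Q = q}"
  have fin: "finite \<Omega>" by (simp add: \<Omega>_def)
  have "card ?T * (s choose q) \<le> (\<Sum>ys\<in>?T. card {Q. Q \<subseteq> ?bad ys \<and> card Q = q})"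
    using sum_bounded_below[of ?T "s choose q" "\<lambda>ys. card {Q. Q \<subseteq> ?bad ys \<and> card Q = q}"]
    by (simp add: n_subsets binomial_right_mono)
  also have "\<dots> = card (SIGMA ys:?T. {Q. Q \<subseteq> ?bad ys \<and> card Q = q})"
    using fin by (intro card_SigmaI[symmetric]) auto
  also have "\<dots> \<le> card (SIGMA Q:?QQ. {ys\<in>\<Omega>. \<forall>i\<in>Q. (!) ys ` S i \<notin> E})"
    using fin by (intro card_inj_on_le[of prod.swap] finite_SigmaI) (auto simp: inj_on_def)
  also have "\<dots> = (\<Sum>Q\<in>?QQ. card {ys\<in>\<Omega>. \<forall>i\<in>Q. (!) ys ` S i \<notin> E})"
    using fin by (intro card_SigmaI) auto
  finally have 1: "card ?T * (s choose q) \<le> (\<Sum>Q\<in>?QQ. card {ys\<in>\<Omega>. \<forall>i\<in>Q. (!) ys ` S i \<notin> E})" .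
  have "card ?T * (s choose q) * (n - k * q) ^ q \<le> 
    (\<Sum>Q\<in>?QQ. card {ys\<in>\<Omega>. \<forall>i\<in>Q. (!) ys ` S i \<notin> E} * (n - k * q) ^ q)"
    using mult_le_mono1[OF 1] by (simp add: sum_distrib_right)
  also have "\<dots> \<le> (\<Sum>Q\<in>?QQ. D ^ q * fact n)"
  proof (rule sum_mono)
    fix Q assume "Q \<in> ?QQ"
    then have Q: "Q \<subseteq> {..<M}" "card Q \<le> q" "card Q = q" by auto
    show "card {ys\<in>\<Omega>. \<forall>i\<in>Q. (!) ys ` S i \<notin> E} * (n - k * q) ^ q \<le> D ^ q * fact n"
      using card_all_nonedges_le[OF V D S[unfolded n_def] p Q(1,2)] by (simp add: Q(3) \<Omega>_def n_def)
  qed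
  also have "\<dots> = (M choose q) * (D ^ q * fact n)" by (simp add: n_subsets)
  finally have 2: "card ?T * (s choose q) * (n - k * q) ^ q \<le> (M choose q) * (D ^ q * fact n)" .
  have "(M choose q) * (s - q) ^ q \<le> (M choose q) * (fact q * (s choose q))"
    using power_diff_le_binomial[OF q] by simp
  also have "\<dots> \<le> M ^ q * (s choose q)"
    using binomial_fact_pow[of M q] by (simp add: mult.assoc[symmetric])
  finally have 3: "(M choose q) * (s - q) ^ q \<le> M ^ q * (s choose q)" .
  have "(s choose q) * (card ?T * ((s - q) * (n - k * q)) ^ q) = 
    (s - q) ^ q * (card ?T * (s choose q) * (n - k * q) ^ q)" by (simp add: power_mult_distrib)
  also have "\<dots> \<le> (s - q) ^ q * ((M choose q) * (D ^ q * fact n))" using 2 by simp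
  also have "\<dots> = (M choose q) * (s - q) ^ q * (D ^ q * fact n)" by simp
  also have "\<dots> \<le> M ^ q * (s choose q) * (D ^ q * fact n)" using 3 by (rule mult_le_mono1)
  also have "\<dots> = (s choose q) * ((M * D) ^ q * fact n)" by (simp add: power_mult_distrib)
  finally show ?thesis using q by simp
qed

section \<open>Hamilton cycles from cyclic orders\<close>

text \<open>\<open>w\<close> stands for k - l, and the list is cut into \<open>m\<close> blocks of
  length \<open>w\<close>: an edge is a block together with the first \<open>l\<close> positions of
  the next one. \<open>l < w\<close> is the condition l < k/2; \<open>3 \<le> m\<close> makes the
  two neighbours of an edge distinct, so that consecutive edges meet in one shared part
  only.\<close>

locale cycle_layout =
  fixes l w m :: nat and xs :: "'a list"
  assumes lw: "l < w" and m: "3 \<le> m" and dist: "distinct xs" and len: "length xs = m * w"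
begin

definition shared where "shared i = (\<lambda>r. xs ! (i * w + r)) ` {..<l}"
definition inner where "inner i = (\<lambda>r. xs ! (i * w + r)) ` {l..<w}"

lemma pos_less: "i < m \<Longrightarrow> r < w \<Longrightarrow> i * w + r < m * w"
  using mult_le_mono1[of "Suc i" m w] by simp

lemma nth_eq_iff:
  assumes "i < m" "r < w" "j < m" "s < w"
  shows "xs ! (i * w + r) = xs ! (j * w + s) \<longleftrightarrow> i = j \<and> r = s"
proof -
  have "xs ! (i * w + r) = xs ! (j * w + s) \<longleftrightarrow> i * w + r = j * w + s"
    using assms pos_less len dist by (simp add: nth_eq_iff_index_eq)
  also have "\<dots> \<longleftrightarrow> i = j \<and> r = s"
  proof
    assume *: "i * w + r = j * w + s"
    have "(i * w + r) div w = i" "(j * w + s) div w = j" using assms by auto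
    with * have "i = j" by metis
    with * show "i = j \<and> r = s" by simp
  qed simp
  finally show ?thesis .
qed

lemma card_shared: "i < m \<Longrightarrow> card (shared i) = l"
  unfolding shared_def using lw by (subst card_image) (auto simp: inj_on_def nth_eq_iff)

lemma card_inner: "i < m \<Longrightarrow> card (inner i) = w - l"
  unfolding inner_def using lw by (subst card_image) (auto simp: inj_on_def nth_eq_iff)

lemma shared_disjoint: "i < m \<Longrightarrow> j < m \<Longrightarrow> i \<noteq> j \<Longrightarrow> shared i \<inter> shared j = {}"
  using lw by (auto simp: shared_def nth_eq_iff)

lemma inner_disjoint: "i < m \<Longrightarrow> j < m \<Longrightarrow> i \<noteq> j \<Longrightarrow> inner i \<inter> inner j = {}"
  using lw by (auto simp: inner_def nth_eq_iff)

lemma shared_inner_disjoint: "i < m \<Longrightarrow> j < m \<Longrightarrow> shared i \<inter> inner j = {}"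
  using lw by (auto simp: inner_def shared_def nth_eq_iff)

lemma inner_nonempty: "inner i \<noteq> {}"
  using lw by (auto simp: inner_def)

definition nxt where "nxt i = Suc i mod m"
definition prv where "prv i = (i + m - 1) mod m"

lemma nxt_less: "nxt i < m" and prv_less: "prv i < m"
  using m by (auto simp: nxt_def prv_def)

lemma nxt_prv: "i < m \<Longrightarrow> nxt (prv i) = i"
  unfolding nxt_def prv_def using m by (simp add: mod_Suc_eq)

lemma nxt_eq: "i < m \<Longrightarrow> nxt i = (if Suc i = m then 0 else Suc i)"
  by (auto simp: nxt_def)

abbreviation edge where "edge i \<equiv> segment (w + l) xs (i * w)"

lemma edge_eq:
  assumes "i < m"
  shows "edge i = shared i \<union> inner i \<union> shared (nxt i)"
proof -
  have 1: "xs ! ((i * w + r) mod length xs) = xs ! (i * w + r)" if "r < w" for r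
    using pos_less[OF assms that] len by simp
  have 2: "xs ! ((i * w + (w + r)) mod length xs) = xs ! (nxt i * w + r)" if "r < l" for r
  proof (cases "Suc i = m")
    case True
    then have "i * w + (w + r) = length xs + r" using len by auto
    moreover have "r < length xs" using pos_less[of 0 r] that lw m len by simp
    ultimately have "(i * w + (w + r)) mod length xs = r" by (metis mod_add_self1 mod_less)
    then show ?thesis using True by (simp add: nxt_eq assms)
  next
    case False
    then have eq: "i * w + (w + r) = nxt i * w + r" using assms by (simp add: nxt_eq)
    show ?thesis unfolding eq len using pos_less[OF nxt_less, of r i] that lw by simp
  qed
  have "edge i = (\<lambda>j. xs ! ((i * w + j) mod length xs)) ` {..<w + l}"
    by (auto simp: segment_def)
  also have "{..<w + l} = {..<l} \<union> {l..<w} \<union> (\<lambda>r. w + r) ` {..<l}"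
  proof -
    have "(\<lambda>r. w + r) ` {..<l} = {w..<w + l}"
      using image_add_atLeastLessThan[of w 0 l] by (simp add: atLeast0LessThan add.commute[of l])
    then show ?thesis using lw by auto
  qed
  also have "(\<lambda>j. xs ! ((i * w + j) mod length xs)) ` \<dots> = 
    (\<lambda>j. xs ! ((i * w + j) mod length xs)) ` {..<l} \<union> (\<lambda>j. xs ! ((i * w + j) mod length xs)) ` {l..<w}
    \<union> (\<lambda>r. xs ! ((i * w + (w + r)) mod length xs)) ` {..<l}"
    by (simp add: image_Un image_image)
  also have "(\<lambda>j. xs ! ((i * w + j) mod length xs)) ` {..<l} = shared i"
    unfolding shared_def using 1 lw by (intro image_cong) auto
  also have "(\<lambda>j. xs ! ((i * w + j) mod length xs)) ` {l..<w} = inner i"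
    unfolding inner_def using 1 by (intro image_cong) auto
  also have "(\<lambda>r. xs ! ((i * w + (w + r)) mod length xs)) ` {..<l} = shared (nxt i)"
    unfolding shared_def using 2 by (intro image_cong) auto
  finally show ?thesis .
qed

lemma nxt_neq: "i < m \<Longrightarrow> nxt i \<noteq> i" "i < m \<Longrightarrow> nxt (nxt i) \<noteq> i"
  using m nxt_less[of i] by (auto simp: nxt_eq split: if_splits)

lemma edge_inter_nxt:
  assumes "i < m"
  shows "edge i \<inter> edge (nxt i) = shared (nxt i)"
proof -
  let ?j = "nxt i" and ?k = "nxt (nxt i)"
  have lt: "?j < m" "?k < m" by (rule nxt_less)+
  have ne: "?j \<noteq> i" "?k \<noteq> i" "?j \<noteq> ?k" using nxt_neq assms lt by metis+
  have d: "shared i \<inter> shared ?j = {}" "shared i \<inter> shared ?k = {}" "shared ?j \<inter> shared ?k = {}"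
    "inner i \<inter> inner ?j = {}" "shared i \<inter> inner ?j = {}" "shared ?j \<inter> inner i = {}"
    "shared ?j \<inter> inner ?j = {}" "shared ?k \<inter> inner i = {}"
    using ne lt assms by (simp_all add: shared_disjoint inner_disjoint shared_inner_disjoint)
  show ?thesis
    unfolding edge_eq[OF assms] edge_eq[OF nxt_less[of i]] Int_Un_distrib Int_Un_distrib2
    using d by (simp add: Int_commute)
qed

lemma edge_disjoint:
  assumes "i < m" "j < m" "i \<noteq> j" "nxt i \<noteq> j" "nxt j \<noteq> i"
  shows "edge i \<inter> edge j = {}"
proof -
  have lt: "nxt i < m" "nxt j < m" by (rule nxt_less)+
  have "nxt i \<noteq> nxt j" using assms by (auto simp: nxt_eq split: if_splits)
  then have d: "shared i \<inter> shared j = {}" "shared i \<inter> shared (nxt j) = {}" "shared (nxt i) \<inter> shared j = {}"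
    "shared (nxt i) \<inter> shared (nxt j) = {}" "inner i \<inter> inner j = {}" "shared i \<inter> inner j = {}" 
    "shared j \<inter> inner i = {}" "shared (nxt i) \<inter> inner j = {}" "shared (nxt j) \<inter> inner i = {}"
    using lt assms by (simp_all add: shared_disjoint inner_disjoint shared_inner_disjoint)
  show ?thesis
    unfolding edge_eq[OF assms(1)] edge_eq[OF assms(2)] Int_Un_distrib Int_Un_distrib2
    using d by (simp add: Int_commute)
qed

lemma inj_on_edge: "inj_on edge {..<m}"
proof (rule inj_onI)
  fix i j assume ij: "i \<in> {..<m}" "j \<in> {..<m}" and eq: "edge i = edge j"
  show "i = j"
  proof (rule ccontr)
    assume ne: "i \<noteq> j"
    have "inner i \<subseteq> edge j" using eq edge_eq[of i] ij by auto
    moreover have "inner i \<inter> edge j = {}"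
      using edge_eq[of j] ij ne inner_disjoint[of i j] shared_inner_disjoint[of j i] 
        shared_inner_disjoint[of "nxt j" i] nxt_less[of j] by blast
    ultimately show False using inner_nonempty by blast
  qed
qed

text \<open>With \<open>inner_eq_edges\<close>, this recovers the parts of every block from the
  sequence of edges, which bounds the number of orders with a given edge list.\<close>

lemma shared_eq_edges:
  assumes "i < m" shows "shared i = edge (prv i) \<inter> edge i"
  using edge_inter_nxt[OF prv_less[of i]] by (simp add: nxt_prv assms)

lemma inner_eq_edges:
  assumes "i < m" shows "inner i = edge i - edge (prv i) \<inter> edge i - edge (prv (nxt i)) \<inter> edge (nxt i)"
proof -
  have "inner i = edge i - shared i - shared (nxt i)"
    using edge_eq[OF assms] assms shared_inner_disjoint[of i i] shared_inner_disjoint[of "nxt i" i] nxt_less[of i] by blast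
  then show ?thesis using shared_eq_edges[OF assms] shared_eq_edges[OF nxt_less[of i]] by simp
qed

lemma set_eq_Union: "set xs = (\<Union>i<m. shared i \<union> inner i)"
proof
  show "set xs \<subseteq> (\<Union>i<m. shared i \<union> inner i)"
  proof
    fix v assume "v \<in> set xs"
    then obtain p where p: "p < m * w" "v = xs ! p" using len by (auto simp: in_set_conv_nth)
    have "p div w < m" using p by (simp add: less_mult_imp_div_less)
    moreover have "v = xs ! (p div w * w + p mod w)" "p mod w < w" using p lw by auto
    then have "v \<in> (\<lambda>r. xs ! (p div w * w + r)) ` ({..<l} \<union> {l..<w})"
      by (metis Un_iff atLeastLessThan_iff image_eqI lessThan_iff not_le_imp_less)
    then have "v \<in> shared (p div w) \<union> inner (p div w)"
      by (simp only: shared_def inner_def image_Un)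
    ultimately show "v \<in> (\<Union>i<m. shared i \<union> inner i)" by blast
  qed
  show "(\<Union>i<m. shared i \<union> inner i) \<subseteq> set xs"
    using pos_less lw len by (auto simp: shared_def inner_def)
qed

lemma Union_edges: "\<Union> (edge ` {..<m}) = set xs"
proof -
  have "edge i \<subseteq> set xs" if "i < m" for i
    using edge_eq[OF that] nxt_less[of i] that unfolding set_eq_Union by blast
  moreover have "shared i \<union> inner i \<subseteq> edge i" if "i < m" for i
    using edge_eq[OF that] by blast
  ultimately show ?thesis unfolding set_eq_Union by blast
qed

lemma kl_cycle_edges:
  shows "kl_cycle (w + l) l (set xs) (edge ` {..<m})"
  unfolding kl_cycle_def
proof (intro exI conjI)
  let ?ss = "map (\<lambda>i. i * w) [0..<m]"
  show "distinct xs" by (rule dist)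
  show "set xs = set xs" ..
  have "2 * w \<le> m * w" using m by (intro mult_le_mono1) simp
  then show "w + l \<le> length xs" using lw len by linarith
  show "sorted_wrt (<) ?ss" using lw by (auto simp: sorted_wrt_iff_nth_less)
  show "set ?ss \<subseteq> {..<length xs}" using lw len by auto
  show "edge ` {..<m} = segment (w + l) xs ` set ?ss" by (auto simp: image_image)
  show "\<Union> (edge ` {..<m}) = set xs" by (rule Union_edges)
  show "\<forall>i<length ?ss. Suc i mod length ?ss \<noteq> i \<longrightarrow>
     card (segment (w + l) xs (?ss ! i) \<inter> segment (w + l) xs (?ss ! (Suc i mod length ?ss))) = l"
    using edge_inter_nxt card_shared nxt_less m by (simp add: nxt_def)
qed

text \<open>An edge determines, together with its predecessor, its successor.\<close>

lemma edges_meeting: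
  assumes i: "Suc i < m" "0 < i" and "0 < l"
  shows "{e \<in> edge ` {..<m}. e \<noteq> edge i \<and> e \<inter> edge i \<noteq> {}} = {edge (i - 1), edge (Suc i)}" (is "?N = _")
    and "edge (i - 1) \<noteq> edge (Suc i)"
proof -
  have lt: "i - 1 < m" "i < m" "Suc i < m" using i by auto
  have n: "nxt i = Suc i" "nxt (i - 1) = i" using i nxt_eq[of i] nxt_eq[of "i - 1"] by auto
  have ne: "shared j \<noteq> {}" if "j < m" for j using card_shared[OF that] \<open>0 < l\<close> by (metis card.empty less_numeral_extra(3))
  have m1: "edge i \<inter> edge (Suc i) \<noteq> {}" "edge (i - 1) \<inter> edge i \<noteq> {}"
    using edge_inter_nxt[OF lt(2)] edge_inter_nxt[OF lt(1)] ne[OF lt(2)] ne[OF lt(3)] unfolding n by metis+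
  have neq: "edge a \<noteq> edge b" if "a < m" "b < m" "a \<noteq> b" for a b
    by (rule inj_on_contraD[OF inj_on_edge that(3)]) (use that in simp_all)
  show "edge (i - 1) \<noteq> edge (Suc i)" by (rule neq) (use lt in linarith)+
  have ne1: "edge (Suc i) \<noteq> edge i" by (rule neq) (use lt in linarith)+
  have ne2: "edge (i - 1) \<noteq> edge i" by (rule neq) (use lt i in linarith)+
  show "?N = {edge (i - 1), edge (Suc i)}"
  proof (rule subset_antisym)
    show "?N \<subseteq> {edge (i - 1), edge (Suc i)}"
    proof
      fix e assume "e \<in> ?N"
      then obtain j where j: "j < m" "e = edge j" "edge j \<noteq> edge i" "edge j \<inter> edge i \<noteq> {}" by blast
      have "j = i - 1 \<or> j = Suc i"
      proof (rule ccontr)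
        assume *: "\<not> (j = i - 1 \<or> j = Suc i)"
        have "j \<noteq> i" using j(3) by metis
        moreover have "nxt j \<noteq> i" using * j(1) i nxt_eq[of j] by (cases "Suc j = m") auto
        moreover have "nxt i \<noteq> j" using * n by metis
        ultimately show False using edge_disjoint[OF j(1) lt(2)] j(4) by metis
      qed
      then show "e \<in> {edge (i - 1), edge (Suc i)}" unfolding j(2) by (elim disjE) simp_all
    qed
    have "edge (i - 1) \<in> edge ` {..<m}" "edge (Suc i) \<in> edge ` {..<m}"
      using lt by (metis imageI lessThan_iff)+
    then show "{edge (i - 1), edge (Suc i)} \<subseteq> ?N" using ne1 ne2 m1 by blast
  qed
qed

end

text \<open>An intermediate stage between a cyclic order and its cycle: the edge list forgets the
  arrangement inside the block parts; the edge set also forgets start and direction, or for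
  \<open>l = 0\<close> the whole sequence.\<close>

definition edge_list :: "nat \<Rightarrow> nat \<Rightarrow> nat \<Rightarrow> 'a list \<Rightarrow> 'a set list" where
  "edge_list k w m xs = map (\<lambda>i. segment k xs (i * w)) [0..<m]"

lemma length_edge_list [simp]: "length (edge_list k w m xs) = m"
  by (simp add: edge_list_def)

lemma nth_edge_list: "i < m \<Longrightarrow> edge_list k w m xs ! i = segment k xs (i * w)"
  by (simp add: edge_list_def)

lemma set_edge_list: "set (edge_list k w m xs) = (\<lambda>i. segment k xs (i * w)) ` {..<m}"
  by (auto simp: edge_list_def)

lemma cycle_layoutI:
  assumes "l < w" "3 \<le> m" "card V = m * w" "xs \<in> permutations_of_set V"
  shows "cycle_layout l w m xs"
  using assms length_finite_permutations_of_set[OF assms(4)]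
  by (auto simp: cycle_layout_def permutations_of_set_def)

lemma card_edge_list_fibre:
  assumes lw: "l < w" and m: "3 \<le> m" and V: "finite V" "card V = m * w"
  shows "card {xs\<in>permutations_of_set V. edge_list (w + l) w m xs = es} \<le> (fact l * fact (w - l)) ^ m"
proof (cases "{xs\<in>permutations_of_set V. edge_list (w + l) w m xs = es} = {}")
  case False
  let ?F = "{xs\<in>permutations_of_set V. edge_list (w + l) w m xs = es}"
  \<comment> \<open>\<open>A i\<close> and \<open>B i\<close> are the shared and the inner part of
    block \<open>i\<close>, computed from the edge list alone.\<close>
  define A where "A i = es ! ((i + m - 1) mod m) \<inter> es ! i" for i
  define B where "B i = es ! i - A i - A (Suc i mod m)" for i
  have layout: "cycle_layout l w m xs" if "xs \<in> ?F" for xs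
    using that lw m V by (intro cycle_layoutI) auto
  have edge: "segment (w + l) xs (i * w) = es ! i" if "xs \<in> ?F" "i < m" for xs i
    using that nth_edge_list[of i m "w + l" w xs] by auto
  have A: "cycle_layout.shared l w xs i = A i" and B: "cycle_layout.inner l w xs i = B i"
    if "xs \<in> ?F" "i < m" for xs i
  proof -
    interpret cycle_layout l w m xs by (rule layout[OF that(1)])
    show "shared i = A i"
      using shared_eq_edges[OF that(2)] edge[OF that(1)] that(2) prv_less[of i] 
      by (simp add: A_def prv_def)
    have "es ! prv (nxt i) \<inter> es ! nxt i = A (Suc i mod m)"
      by (simp add: A_def prv_def nxt_def)
    then show "inner i = B i"
      using inner_eq_edges[OF that(2)] edge[OF that(1)] that(2) prv_less nxt_less
      by (simp add: A_def B_def prv_def)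
  qed
  obtain xs0 where xs0: "xs0 \<in> ?F" using False by blast
  have cA: "card (A i) = l" and cB: "card (B i) = w - l" if "i < m" for i
    using A[OF xs0 that] B[OF xs0 that] cycle_layout.card_shared[OF layout[OF xs0] that]
      cycle_layout.card_inner[OF layout[OF xs0] that] by auto
  have fin: "finite (A i)" "finite (B i)" if "i < m" for i
    unfolding A[OF xs0 that, symmetric] B[OF xs0 that, symmetric] 
      cycle_layout.shared_def[OF layout[OF xs0]] cycle_layout.inner_def[OF layout[OF xs0]] by simp_all
  define f where "f xs = (\<lambda>i\<in>{..<m}. (map (\<lambda>r. xs ! (i * w + r)) [0..<l], map (\<lambda>r. xs ! (i * w + r)) [l..<w]))" 
    for xs :: "'a list"
  let ?T = "PiE {..<m} (\<lambda>i. permutations_of_set (A i) \<times> permutations_of_set (B i))"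
  have "f ` ?F \<subseteq> ?T"
  proof (rule image_subsetI)
    fix xs assume xs: "xs \<in> ?F"
    interpret cycle_layout l w m xs by (rule layout[OF xs])
    have "map (\<lambda>r. xs ! (i * w + r)) [0..<l] \<in> permutations_of_set (A i)" if "i < m" for i
      unfolding A[OF xs that, symmetric] using that lw
      by (intro permutations_of_setI) (auto simp: distinct_map inj_on_def nth_eq_iff shared_def atLeast0LessThan)
    moreover have "map (\<lambda>r. xs ! (i * w + r)) [l..<w] \<in> permutations_of_set (B i)" if "i < m" for i
      unfolding B[OF xs that, symmetric] using that lw
      by (intro permutations_of_setI) (auto simp: distinct_map inj_on_def nth_eq_iff inner_def)
    ultimately show "f xs \<in> ?T" by (auto simp: f_def)
  qed
  moreover have "inj_on f ?F"
  proof (rule inj_onI)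
    fix xs ys assume xs: "xs \<in> ?F" and ys: "ys \<in> ?F" and eq: "f xs = f ys"
    show "xs = ys"
    proof (rule nth_equalityI)
      show len: "length xs = length ys"
        using xs ys length_finite_permutations_of_set[of xs V] length_finite_permutations_of_set[of ys V] by simp
      fix p assume "p < length xs"
      then have p: "p < m * w" using xs V length_finite_permutations_of_set[of xs V] by simp
      define i r where "i = p div w" and "r = p mod w"
      have i: "i < m" using p by (simp add: i_def less_mult_imp_div_less)
      have r: "r < w" using lw by (simp add: r_def)
      have "f xs i = f ys i" using eq by simp
      then have eqs: "map (\<lambda>r. xs ! (i * w + r)) [0..<l] = map (\<lambda>r. ys ! (i * w + r)) [0..<l]"
        "map (\<lambda>r. xs ! (i * w + r)) [l..<w] = map (\<lambda>r. ys ! (i * w + r)) [l..<w]"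
        using i by (auto simp: f_def)
      have "xs ! (i * w + r) = ys ! (i * w + r)"
      proof (cases "r < l")
        case True
        then show ?thesis using eqs(1) by (simp add: map_eq_conv)
      next
        case False
        then show ?thesis using eqs(2) r by (simp add: map_eq_conv)
      qed
      then show "xs ! p = ys ! p" by (simp add: i_def r_def)
    qed
  qed
  ultimately have "card ?F \<le> card ?T" by (intro card_inj_on_le finite_PiE) auto
  also have "card ?T = (\<Prod>i<m. card (permutations_of_set (A i) \<times> permutations_of_set (B i)))"
    by (rule card_PiE) simp
  also have "\<dots> = (\<Prod>i<m. fact l * fact (w - l))"
    using fin cA cB by (intro prod.cong) (auto simp: card_cartesian_product)
  finally show ?thesis by simp
qed (simp only: card.empty le0)

text \<open>For \<open>l > 0\<close> the first two edges determine the rest, since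
  \<open>edges_meeting\<close> leaves one choice for each next edge; the crude square is absorbed
  later. For \<open>l = 0\<close> the edges are disjoint and may come in any order, which is the
  source of the factorial in the final theorem.\<close>

lemma card_edge_lists_of_cycle:
  assumes lw: "l < w" and m: "3 \<le> m" and V: "finite V" "card V = m * w"
  shows "card (edge_list (w + l) w m ` {xs\<in>permutations_of_set V. set (edge_list (w + l) w m xs) = C}) 
    \<le> (if l = 0 then fact m else m\<^sup>2)"
proof (cases "{xs\<in>permutations_of_set V. set (edge_list (w + l) w m xs) = C} = {}")
  case False
  let ?F = "{xs\<in>permutations_of_set V. set (edge_list (w + l) w m xs) = C}"
  have layout: "cycle_layout l w m xs" if "xs \<in> ?F" for xs
    using that lw m V by (intro cycle_layoutI) auto
  have C: "C = (\<lambda>i. segment (w + l) xs (i * w)) ` {..<m}" if "xs \<in> ?F" for xs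
    using that by (auto simp: set_edge_list)
  have distinct: "distinct (edge_list (w + l) w m xs)" if "xs \<in> ?F" for xs
    using cycle_layout.inj_on_edge[OF layout[OF that]] 
    by (auto simp: edge_list_def distinct_map atLeast0LessThan)
  obtain xs0 where xs0: "xs0 \<in> ?F" using False by blast
  have cC: "card C = m" using distinct[OF xs0] xs0 distinct_card by fastforce
  have fC: "finite C" using xs0 by auto
  show ?thesis
  proof (cases "l = 0")
    case True
    have "edge_list (w + l) w m ` ?F \<subseteq> permutations_of_set C"
      using distinct by (auto simp: permutations_of_set_def)
    then have "card (edge_list (w + l) w m ` ?F) \<le> card (permutations_of_set C)"
      by (intro card_mono) auto
    then show ?thesis using True fC cC by simp
  next
    case False
    let ?g = "\<lambda>es :: 'a set list. (es ! 0, es ! 1)"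
    have "inj_on ?g (edge_list (w + l) w m ` ?F)"
    proof (rule inj_onI)
      fix es es' assume "es \<in> edge_list (w + l) w m ` ?F" "es' \<in> edge_list (w + l) w m ` ?F" and eq: "?g es = ?g es'"
      then obtain xs xs' where xs: "xs \<in> ?F" "es = edge_list (w + l) w m xs"
        and xs': "xs' \<in> ?F" "es' = edge_list (w + l) w m xs'" by blast
      interpret X: cycle_layout l w m xs by (rule layout[OF xs(1)])
      interpret X': cycle_layout l w m xs' by (rule layout[OF xs'(1)])
      have nth: "es ! i = X.edge i" "es' ! i = X'.edge i" if "i < m" for i
        using that xs xs' by (auto simp: nth_edge_list)
      \<comment> \<open>Two consecutive edges are carried, because the next edge is the neighbour of
        the current one other than the previous one.\<close>
      have "es ! i = es' ! i \<and> (Suc i < m \<longrightarrow> es ! Suc i = es' ! Suc i)" if "i < m" for i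
        using that
      proof (induction i)
        case 0
        then show ?case using eq by simp
      next
        case (Suc i)
        show ?case
        proof (intro conjI impI)
          show IH: "es ! Suc i = es' ! Suc i" using Suc by simp
          have IH': "es ! i = es' ! i" using Suc by simp
          assume i: "Suc (Suc i) < m"
          let ?N = "{e \<in> C. e \<noteq> es ! Suc i \<and> e \<inter> es ! Suc i \<noteq> {}}"
          have "?N = {es ! i, es ! Suc (Suc i)}" "es ! i \<noteq> es ! Suc (Suc i)"
            using X.edges_meeting[of "Suc i"] C[OF xs(1)] i False by (simp_all only: nth) auto
          moreover have "?N = {es' ! i, es' ! Suc (Suc i)}" "es' ! i \<noteq> es' ! Suc (Suc i)"
            using X'.edges_meeting[of "Suc i"] C[OF xs'(1)] i False unfolding IH by (simp_all only: nth) auto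
          ultimately show "es ! Suc (Suc i) = es' ! Suc (Suc i)" using IH' by (metis doubleton_eq_iff)
        qed
      qed
      then show "es = es'" using xs xs' by (intro nth_equalityI) auto
    qed
    moreover have "?g ` edge_list (w + l) w m ` ?F \<subseteq> C \<times> C"
    proof -
      have "edge_list (w + l) w m xs ! i \<in> C" if "xs \<in> ?F" "i < m" for xs i
        using that nth_mem[of i "edge_list (w + l) w m xs"] by auto
      then show ?thesis using m by auto
    qed
    ultimately have "card (edge_list (w + l) w m ` ?F) \<le> card (C \<times> C)"
      using fC by (intro card_inj_on_le[of ?g]) auto
    then show ?thesis using False cC by (simp add: card_cartesian_product power2_eq_square)
  qed
qed (simp only: image_empty card.empty le0)

lemma card_cyclic_orders_le:
  assumes lw: "l < w" and m: "3 \<le> m" and V: "finite V" "card V = m * w" and E: "finite E"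
  shows "card {xs\<in>permutations_of_set V. set (edge_list (w + l) w m xs) \<subseteq> E} \<le> 
    card (hamilton_cycles (w + l) l V E) * ((if l = 0 then fact m else m\<^sup>2) * (fact l * fact (w - l)) ^ m)"
proof -
  let ?el = "edge_list (w + l) w m :: 'a list \<Rightarrow> 'a set list"
  let ?\<Omega> = "permutations_of_set V"
  let ?H = "hamilton_cycles (w + l) l V E"
  let ?a = "if l = 0 then fact m else m\<^sup>2" and ?b = "(fact l * fact (w - l)) ^ m"
  have fH: "finite ?H" using E by (intro finite_subset[of ?H "Pow E"]) (auto simp: hamilton_cycles_def)
  have "set (?el xs) \<in> ?H" if "xs \<in> ?\<Omega>" "set (?el xs) \<subseteq> E" for xs
  proof -
    interpret cycle_layout l w m xs by (rule cycle_layoutI[OF lw m V(2) that(1)])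
    show ?thesis using kl_cycle_edges that
      by (auto simp: hamilton_cycles_def set_edge_list permutations_of_set_def)
  qed
  then have "{xs\<in>?\<Omega>. set (?el xs) \<subseteq> E} \<subseteq> (\<Union>C\<in>?H. {xs\<in>?\<Omega>. set (?el xs) = C})" by blast
  then have "card {xs\<in>?\<Omega>. set (?el xs) \<subseteq> E} \<le> card (\<Union>C\<in>?H. {xs\<in>?\<Omega>. set (?el xs) = C})"
    using fH by (intro card_mono) auto
  also have "\<dots> \<le> (\<Sum>C\<in>?H. card {xs\<in>?\<Omega>. set (?el xs) = C})" by (rule card_UN_le[OF fH])
  also have "\<dots> \<le> (\<Sum>C\<in>?H. ?a * ?b)"
  proof (rule sum_mono)
    fix C
    let ?I = "?el ` {xs\<in>?\<Omega>. set (?el xs) = C}"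
    have "{xs\<in>?\<Omega>. set (?el xs) = C} \<subseteq> (\<Union>es\<in>?I. {xs\<in>?\<Omega>. ?el xs = es})" by blast
    then have "card {xs\<in>?\<Omega>. set (?el xs) = C} \<le> card (\<Union>es\<in>?I. {xs\<in>?\<Omega>. ?el xs = es})"
      by (intro card_mono) auto
    also have "\<dots> \<le> (\<Sum>es\<in>?I. card {xs\<in>?\<Omega>. ?el xs = es})" by (intro card_UN_le) auto
    also have "\<dots> \<le> card ?I * ?b"
      using sum_bounded_above[of ?I "\<lambda>es. card {xs\<in>?\<Omega>. ?el xs = es}" ?b] card_edge_list_fibre[OF lw m V] by simp
    also have "\<dots> \<le> ?a * ?b" by (rule mult_le_mono1[OF card_edge_lists_of_cycle[OF lw m V]])
    finally show "card {xs\<in>?\<Omega>. set (?el xs) = C} \<le> ?a * ?b" .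
  qed
  finally show ?thesis by simp
qed

section \<open>Matching special vertices with partial edges\<close>

text \<open>Expansion of the permanent along its first column corresponds to the choice of the first
  entry of \<open>xs\<close>.\<close>

lemma mixed_perm_count:
  assumes "finite X" "card X = length Rs"
  shows "mixed_perm X (map (\<lambda>R x. of_bool (R x)) Rs) y = 
    real (card {xs\<in>permutations_of_set X. list_all2 (\<lambda>R x. R x) Rs xs})"
  using assms
proof (induction Rs arbitrary: X)
  case Nil
  then have "{xs \<in> permutations_of_set X. list_all2 (\<lambda>R x. R x) [] xs} = {[]}" by auto
  then show ?case using Nil by simp
next
  case (Cons R Rs)
  let ?P = "\<lambda>X. {xs\<in>permutations_of_set X. list_all2 (\<lambda>R x. R x) Rs xs}"
  have "X \<noteq> {}" using Cons.prems by auto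
  then have "{xs\<in>permutations_of_set X. list_all2 (\<lambda>R x. R x) (R # Rs) xs} = 
    (\<lambda>(x, xs). x # xs) ` (SIGMA x:{x\<in>X. R x}. ?P (X - {x}))"
    by (auto simp: permutations_of_set_nonempty image_iff)
  also have "card \<dots> = card (SIGMA x:{x\<in>X. R x}. ?P (X - {x}))"
    by (intro card_image) (auto simp: inj_on_def)
  also have "\<dots> = (\<Sum>x\<in>{x\<in>X. R x}. card (?P (X - {x})))"
    using Cons.prems by (intro card_SigmaI) auto
  also have "real \<dots> = (\<Sum>x\<in>X. of_bool (R x) * real (card (?P (X - {x}))))"
    using Cons.prems(1) by (simp add: sum.inter_filter of_bool_def if_distrib if_distribR cong: if_cong)
  also have "\<dots> = mixed_perm X (map (\<lambda>R x. of_bool (R x)) (R # Rs)) y"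
    using Cons by simp
  finally show ?case ..
qed

lemma card_dense_matchings_ge:
  fixes R :: "nat \<Rightarrow> 'b \<Rightarrow> bool"
  assumes X: "finite X" "card X = m"
    and row: "\<And>x. x \<in> X \<Longrightarrow> card {i. i < m \<and> \<not> R i x} \<le> z"
    and col: "\<And>i. i < m \<Longrightarrow> card {x\<in>X. \<not> R i x} \<le> z"
    and z: "1 \<le> z" "2 * z \<le> m"
  shows "real (m - z) ^ m * exp (- real m) \<le> real (card {xs\<in>permutations_of_set X. \<forall>i<m. R i (xs ! i)})"
proof -
  let ?Rs = "map R [0..<m]" and ?C = "map (\<lambda>R x. of_bool (R x) :: real) (map R [0..<m])"
  have len: "length ?C = m" by simp
  have "real (m - z) ^ m * exp (- real (length ?C)) \<le> mixed_perm X ?C (\<lambda>_. 0)"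
  proof (rule mixed_perm_capacity)
    fix x :: "nat \<Rightarrow> real" assume x: "\<And>j. 0 < x j"
    show "real (m - z) ^ m * (\<Prod>j<length ?C. x j) \<le> (\<Prod>i\<in>X. \<Sum>j<length ?C. x j * (?C ! j) i)"
      unfolding len
    proof (rule zero_one_matrix_capacity[OF X len _ _ _ z x])
      fix i assume "i \<in> X"
      then show "card {j. j < m \<and> (?C ! j) i = 0} \<le> z"
        using row[of i] by (simp add: conj_commute cong: conj_cong)
    next
      fix j assume "j < m"
      then show "card {i\<in>X. (?C ! j) i = 0} \<le> z" using col[of j] by simp
    qed auto
  qed (use X z in auto)
  also have "mixed_perm X ?C (\<lambda>_. 0) = real (card {xs\<in>permutations_of_set X. list_all2 (\<lambda>R x. R x) ?Rs xs})"
    using X by (intro mixed_perm_count) auto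
  also have "{xs\<in>permutations_of_set X. list_all2 (\<lambda>R x. R x) ?Rs xs} = {xs\<in>permutations_of_set X. \<forall>i<m. R i (xs ! i)}"
    using X length_finite_permutations_of_set[of _ X] by (auto simp: list_all2_conv_all_nth)
  finally show ?thesis unfolding len .
qed

text \<open>Once the first \<open>N\<close> vertices are placed, the remaining \<open>m\<close> vertices have to be matched with
  the \<open>m\<close> partial edges given by \<open>T\<close>.\<close>

lemma card_completions_ge:
  fixes V :: "'a set" and T :: "nat \<Rightarrow> nat set" and E :: "'a set set" and z N m :: nat
  defines "\<Omega> \<equiv> permutations_of_set V"
  defines "nice \<equiv> \<lambda>ys. (\<forall>i<m. card {j. j < m \<and> (!) ys ` insert (N + j) (T i) \<notin> E} \<le> z) \<and> 
      (\<forall>j<m. card {i. i < m \<and> (!) ys ` insert (N + j) (T i) \<notin> E} \<le> z)"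
  defines "good \<equiv> \<lambda>ys. \<forall>i<m. (!) ys ` insert (N + i) (T i) \<in> E"
  assumes V: "finite V" "card V = N + m" and T: "\<And>i. i < m \<Longrightarrow> T i \<subseteq> {..<N}"
    and z: "1 \<le> z" "2 * z \<le> m"
  shows "real (card {ys\<in>\<Omega>. nice ys}) * (real (m - z) ^ m * exp (- real m)) \<le> fact m * real (card {ys\<in>\<Omega>. good ys})"
proof -
  define K where "K = real (m - z) ^ m * exp (- real m)"
  \<comment> \<open>Orders are grouped by their first \<open>N\<close> entries. One nice member
    suffices for a group, as reordering the last \<open>m\<close> entries only permutes the rows of
    the matrix; the group then has at most \<open>fact m\<close> members, at least \<open>K\<close>
    of them good.\<close>
  let ?P = "take N ` {ys\<in>\<Omega>. nice ys}"
  let ?cl = "\<lambda>ns. {ys\<in>\<Omega>. take N ys = ns}"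
  have fin: "finite \<Omega>" by (simp add: \<Omega>_def)
  have cl: "?cl (take N ys) \<subseteq> (\<lambda>sp. take N ys @ sp) ` permutations_of_set (V - set (take N ys))"
    "(\<lambda>sp. take N ys @ sp) ` permutations_of_set (V - set (take N ys)) \<subseteq> ?cl (take N ys)"
    "card (V - set (take N ys)) = m" "length ys = N + m" "V - set (take N ys) = (\<lambda>j. ys ! (N + j)) ` {..<m}"
    "distinct ys"
    if "ys \<in> \<Omega>" for ys
  proof -
    have ys: "set ys = V" "distinct ys" "length ys = N + m"
      using that length_finite_permutations_of_set[of ys V] V by (auto simp: \<Omega>_def permutations_of_set_def)
    show "length ys = N + m" "distinct ys" by fact+
    have "card (set (take N ys)) = N" using ys by (simp add: distinct_card)
    then show "card (V - set (take N ys)) = m"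
      using ys V by (subst card_Diff_subset) (auto dest: in_set_takeD)
    have drop: "set (drop N zs) = V - set (take N zs) \<and> distinct (drop N zs)" if "zs \<in> \<Omega>" for zs
    proof -
      have "distinct (take N zs @ drop N zs)" "set (take N zs @ drop N zs) = V"
        using that by (auto simp: \<Omega>_def permutations_of_set_def simp del: append_take_drop_id simp: append_take_drop_id)
      then show ?thesis unfolding distinct_append set_append by blast
    qed
    have "set (drop N ys) = (\<lambda>j. ys ! (N + j)) ` {..<m}"
      using ys by (force simp: set_conv_nth)
    with drop[OF that] show "V - set (take N ys) = (\<lambda>j. ys ! (N + j)) ` {..<m}" by simp
    show "?cl (take N ys) \<subseteq> (\<lambda>sp. take N ys @ sp) ` permutations_of_set (V - set (take N ys))"
    proof
      fix zs assume "zs \<in> ?cl (take N ys)"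
      then have "zs \<in> \<Omega>" "take N zs = take N ys" by auto
      then show "zs \<in> (\<lambda>sp. take N ys @ sp) ` permutations_of_set (V - set (take N ys))"
        using drop[of zs] append_take_drop_id[of N zs]
        by (intro image_eqI[of _ _ "drop N zs"]) (auto intro!: permutations_of_setI)
    qed
    have "length (take N ys) = N" using ys by simp
    moreover have "set (take N ys) \<subseteq> V" using ys by (auto dest: in_set_takeD)
    ultimately show "(\<lambda>sp. take N ys @ sp) ` permutations_of_set (V - set (take N ys)) \<subseteq> ?cl (take N ys)"
      using ys by (auto simp: \<Omega>_def permutations_of_set_def)
  qed
  have "card {ys\<in>\<Omega>. nice ys} \<le> card (\<Union>ns\<in>?P. ?cl ns)"
    using fin by (intro card_mono) auto
  also have "\<dots> \<le> (\<Sum>ns\<in>?P. card (?cl ns))" using fin by (intro card_UN_le) auto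
  also have "\<dots> \<le> (\<Sum>ns\<in>?P. fact m)"
  proof (rule sum_mono)
    fix ns assume "ns \<in> ?P"
    then obtain ys where ys: "ys \<in> \<Omega>" "ns = take N ys" by blast
    have "card (?cl ns) \<le> card ((\<lambda>sp. ns @ sp) ` permutations_of_set (V - set ns))"
      using cl(1)[OF ys(1)] ys(2) by (intro card_mono) auto
    also have "\<dots> \<le> card (permutations_of_set (V - set ns))" by (intro card_image_le) simp
    also have "\<dots> = fact m" using cl(3)[OF ys(1)] ys(2) V by simp
    finally show "card (?cl ns) \<le> fact m" .
  qed
  finally have 1: "card {ys\<in>\<Omega>. nice ys} \<le> card ?P * fact m" by simp
  have "real (card ?P) * K = (\<Sum>ns\<in>?P. K)" by simp
  also have "\<dots> \<le> (\<Sum>ns\<in>?P. real (card {ys\<in>?cl ns. good ys}))"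
  proof (rule sum_mono)
    fix ns assume "ns \<in> ?P"
    then obtain ys where ys: "ys \<in> \<Omega>" "nice ys" "ns = take N ys" by blast
    note c = cl[OF ys(1), folded ys(3)]
    have lenns: "length ns = N" using c ys by simp
    define R where "R i x \<longleftrightarrow> insert x ((!) ns ` T i) \<in> E" for i x
    have im: "(!) (ns @ sp) ` insert (N + j) (T i) = insert (sp ! j) ((!) ns ` T i)" if "i < m" for sp i j
    proof -
      have "(!) (ns @ sp) ` T i = (!) ns ` T i"
        using T[OF that] lenns by (intro image_cong refl) (auto simp: nth_append)
      then show ?thesis using lenns by (simp add: nth_append)
    qed
    have R: "R i (ys ! (N + j)) \<longleftrightarrow> (!) ys ` insert (N + j) (T i) \<in> E" if "i < m" "j < m" for i j
      using im[OF that(1), of "drop N ys" j] ys(3) c(4) that by (simp add: R_def)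
    have "K \<le> real (card {sp\<in>permutations_of_set (V - set ns). \<forall>i<m. R i (sp ! i)})"
      unfolding K_def
    proof (rule card_dense_matchings_ge[OF _ _ _ _ z])
      fix x assume "x \<in> V - set ns"
      then obtain j where "j < m" "x = ys ! (N + j)" using c(5) by auto
      then have "{i. i < m \<and> \<not> R i x} = {i. i < m \<and> (!) ys ` insert (N + j) (T i) \<notin> E}"
        using R by blast
      then show "card {i. i < m \<and> \<not> R i x} \<le> z" using ys(2) \<open>j < m\<close> by (simp add: nice_def)
    next
      fix i assume i: "i < m"
      have "{x\<in>V - set ns. \<not> R i x} \<subseteq> (\<lambda>j. ys ! (N + j)) ` {j. j < m \<and> (!) ys ` insert (N + j) (T i) \<notin> E}"
        unfolding c(5) using R[OF i] by auto
      then have "card {x\<in>V - set ns. \<not> R i x} \<le> card ((\<lambda>j. ys ! (N + j)) ` {j. j < m \<and> (!) ys ` insert (N + j) (T i) \<notin> E})"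
        by (intro card_mono) auto
      also have "\<dots> \<le> card {j. j < m \<and> (!) ys ` insert (N + j) (T i) \<notin> E}" by (intro card_image_le) auto
      also have "\<dots> \<le> z" using ys(2) i by (simp add: nice_def)
      finally show "card {x\<in>V - set ns. \<not> R i x} \<le> z" .
    qed (use c V in auto)
    also have "card {sp\<in>permutations_of_set (V - set ns). \<forall>i<m. R i (sp ! i)} \<le> card {ys\<in>?cl ns. good ys}"
    proof (rule card_inj_on_le[of "\<lambda>sp. ns @ sp"])
      show "(\<lambda>sp. ns @ sp) ` {sp\<in>permutations_of_set (V - set ns). \<forall>i<m. R i (sp ! i)} \<subseteq> {ys\<in>?cl ns. good ys}"
        using c(2) im by (fastforce simp: good_def R_def)
    qed (use fin in \<open>auto simp: inj_on_def\<close>)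
    finally show "K \<le> real (card {ys\<in>?cl ns. good ys})" by simp
  qed
  also have "\<dots> = real (\<Sum>ns\<in>?P. card {ys\<in>?cl ns. good ys})" by simp
  also have "(\<Sum>ns\<in>?P. card {ys\<in>?cl ns. good ys}) = card (\<Union>ns\<in>?P. {ys\<in>?cl ns. good ys})"
    using fin by (intro card_UN_disjoint[symmetric]) auto
  also have "\<dots> \<le> card {ys\<in>\<Omega>. good ys}" using fin by (intro card_mono) auto
  finally have 2: "real (card ?P) * K \<le> real (card {ys\<in>\<Omega>. good ys})" by simp
  have K: "0 \<le> K" by (simp add: K_def)
  have "real (card {ys\<in>\<Omega>. nice ys}) * K \<le> real (card ?P * fact m) * K"
    using 1 K by (intro mult_right_mono) (simp_all only: of_nat_le_iff)
  also have "\<dots> = fact m * (real (card ?P) * K)" by simp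
  also have "\<dots> \<le> fact m * real (card {ys\<in>\<Omega>. good ys})" using 2 by (intro mult_left_mono) auto
  finally show ?thesis by (simp add: K_def)
qed

section \<open>Choice of parameters\<close>

text \<open>Upper half of Stirling's formula, from \<open>(1 + 1/m)^(m + 1)\<close> being at least
  e. It sets the e^(-m) of the capacity bound against the number of completions.\<close>

lemma fact_le_power_exp:
  assumes "1 \<le> m"
  shows "fact m * exp (real m) \<le> exp 1 * real m * real m ^ m"
  using assms
proof (induction m rule: dec_induct)
  case (step m)
  have m: "0 < real m" using step by simp
  have "1 / (real m + 1) \<le> ln ((real m + 1) / real m)"
    using ln_le_minus_one[of "real m / (real m + 1)"] m by (simp add: ln_div field_simps)
  then have "1 \<le> real (Suc m) * ln ((real m + 1) / real m)" by (simp add: field_simps)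
  then have "exp 1 \<le> exp (ln ((real m + 1) / real m) * real (Suc m))" by (simp add: mult.commute)
  also have "\<dots> = ((real m + 1) / real m) ^ Suc m" using m by (subst exp_of_nat2_mult) (simp add: add_pos_pos)
  finally have e: "exp 1 * real m ^ Suc m \<le> real (Suc m) ^ Suc m"
    using m by (simp add: power_divide field_simps del: power_Suc)
  have "fact (Suc m) * exp (real (Suc m)) = real (Suc m) * exp 1 * (fact m * exp (real m))"
    by (simp add: exp_add)
  also have "\<dots> \<le> real (Suc m) * exp 1 * (exp 1 * real m * real m ^ m)"
    using step.IH by (intro mult_left_mono) auto
  also have "\<dots> = exp 1 * real (Suc m) * (exp 1 * real m ^ Suc m)" by simp
  also have "\<dots> \<le> exp 1 * real (Suc m) * real (Suc m) ^ Suc m" using e by (intro mult_left_mono) auto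
  finally show ?case .
qed simp

lemma eventually_poly_geometric_le:
  fixes c r :: real
  assumes "0 < r" "r < 1"
  shows "eventually (\<lambda>m::nat. c * real m ^ 3 * r ^ m \<le> 1) sequentially"
  using assms by real_asymp

text \<open>\<delta> is the density 1 - \<alpha> of non-neighbours, \<open>z\<close> is about
  (\<delta> + \<epsilon>) m, the number of zeros tolerated in a line, and \<open>q\<close> about
  \<epsilon> m / 8, the order of the moment. Then \<open>z - q\<close> is at least (\<delta> + 5
  \<epsilon> / 8) m, and \<open>m * w - k * q\<close> at least (1 - \<epsilon> / 4) m w because
  \<open>k \<le> 2 * w\<close>. So \<rho> can stay below 1, and its power beats
  \<open>4 * m\<close>.\<close>

lemma eventually_tail_parameters:
  fixes \<delta> \<epsilon> :: real
  assumes \<delta>: "0 \<le> \<delta>" and \<epsilon>: "0 < \<epsilon>" and \<delta>\<epsilon>: "\<delta> + \<epsilon> \<le> 1/2" and k: "k \<le> 2 * w" and w: "0 < w"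
  shows "eventually (\<lambda>m. \<exists>z q \<rho>. 1 \<le> z \<and> 2 * z \<le> m \<and> q \<le> z \<and> 0 < (z - q) * (m * w - k * q) \<and>
    real (m - z) \<ge> (1 - \<delta> - \<epsilon>) * real m \<and>
    (\<forall>D. real D \<le> \<delta> * real (m * w) \<longrightarrow> real (m * D) \<le> \<rho> * real ((z - q) * (m * w - k * q))) \<and> 
    4 * real m * \<rho> ^ q \<le> 1) sequentially"
proof -
  \<comment> \<open>The \<epsilon> / 8 in the numerator keeps \<rho> positive when \<delta> = 0;
    otherwise \<open>ln \<rho>\<close> below would be \<open>ln 0\<close>.\<close>
  define \<rho> where "\<rho> = (\<delta> + \<epsilon> / 8) / (\<delta> + \<epsilon> / 4)"
  have \<rho>: "0 < \<rho>" "\<rho> < 1" using \<delta> \<epsilon> by (auto simp: \<rho>_def field_simps intro!: divide_pos_pos)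
  define c where "c = - ln \<rho>"
  have c: "c > 0" using \<rho> by (simp add: c_def)
  have "eventually (\<lambda>m::nat. 4 * real m * exp (- c * (\<epsilon> / 8 * real m - 1)) \<le> 1) sequentially"
    using c \<epsilon> by real_asymp
  moreover have "eventually (\<lambda>m::nat. 1 \<le> \<epsilon> / 4 * real m) sequentially"
    using \<epsilon> by real_asymp
  ultimately show ?thesis
  proof eventually_elim
    case (elim m)
    then have m: "0 < real m" by (cases "m = 0") auto
    define z where "z = nat \<lfloor>(\<delta> + \<epsilon>) * real m\<rfloor>"
    define q where "q = nat \<lfloor>\<epsilon> / 8 * real m\<rfloor>"
    have floor: "real (nat \<lfloor>x\<rfloor>) \<le> x" "real (nat \<lfloor>x\<rfloor>) \<ge> x - 1" if "0 \<le> x" for x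
      using that by linarith+
    have z: "real z \<le> (\<delta> + \<epsilon>) * real m" "real z \<ge> (\<delta> + \<epsilon>) * real m - 1"
      using \<delta> \<epsilon> unfolding z_def by (auto intro!: floor)
    have q: "real q \<le> \<epsilon> / 8 * real m" "real q \<ge> \<epsilon> / 8 * real m - 1"
      using \<epsilon> floor[of "\<epsilon> / 8 * real m"] unfolding q_def by auto
    have zq: "real z - real q \<ge> (\<delta> + 5 * \<epsilon> / 8) * real m" using z q elim(2) by (simp add: algebra_simps)
    then have "real z - real q > 0" using m \<delta> \<epsilon> by (smt (verit) mult_pos_pos divide_pos_pos)
    then have qz: "q < z" by simp
    have "(\<delta> + \<epsilon>) * real m \<le> 1/2 * real m" using \<delta>\<epsilon> by (intro mult_right_mono) auto
    then have z2: "2 * z \<le> m" using z by simp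
    have "real (k * q) \<le> 2 * real w * (\<epsilon> / 8 * real m)"
      unfolding of_nat_mult using k q(1) \<epsilon> by (intro mult_mono) auto
    then have kq: "real (m * w) - real (k * q) \<ge> (1 - \<epsilon> / 4) * real (m * w)" by (simp add: algebra_simps)
    have e1: "\<epsilon> \<le> 1/2" using \<delta> \<delta>\<epsilon> by simp
    have "(1 - \<epsilon> / 4) * real (m * w) > 0" using e1 m w by simp
    then have kq': "k * q < m * w" using kq by linarith
    have X: "real ((z - q) * (m * w - k * q)) = (real z - real q) * (real (m * w) - real (k * q))"
      using qz kq' by (simp add: of_nat_diff)
    have "(\<delta> + \<epsilon> / 4) * real m * real (m * w) = (\<delta> + \<epsilon> / 4) * (real m * real (m * w))" by simp
    also have "\<dots> \<le> (\<delta> + 5 * \<epsilon> / 8) * (1 - \<epsilon> / 4) * (real m * real (m * w))"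
    proof (intro mult_right_mono)
      have "\<delta> * \<epsilon> \<le> 1/2 * \<epsilon>" "\<epsilon> * \<epsilon> \<le> 1/2 * \<epsilon>" using \<epsilon> \<delta> \<delta>\<epsilon> by (auto intro!: mult_right_mono)
      moreover have "(\<delta> + 5 * \<epsilon> / 8) * (1 - \<epsilon> / 4) = \<delta> + 5 / 8 * \<epsilon> - 1 / 4 * (\<delta> * \<epsilon>) - 5 / 32 * (\<epsilon> * \<epsilon>)"
        by (simp add: field_simps)
      ultimately show "\<delta> + \<epsilon> / 4 \<le> (\<delta> + 5 * \<epsilon> / 8) * (1 - \<epsilon> / 4)" using \<epsilon> by linarith
    qed auto
    also have "\<dots> = ((\<delta> + 5 * \<epsilon> / 8) * real m) * ((1 - \<epsilon> / 4) * real (m * w))" by simp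
    also have "\<dots> \<le> (real z - real q) * (real (m * w) - real (k * q))"
      using zq kq e1 \<delta> \<epsilon> qz by (intro mult_mono) auto
    finally have X': "(\<delta> + \<epsilon> / 4) * real m * real (m * w) \<le> real ((z - q) * (m * w - k * q))" by (simp only: X)
    have "real (m * D) \<le> \<rho> * real ((z - q) * (m * w - k * q))" if D: "real D \<le> \<delta> * real (m * w)" for D
    proof -
      have "real (m * D) \<le> real m * (\<delta> * real (m * w))" unfolding of_nat_mult[of m D] using D by (intro mult_left_mono) auto
      also have "\<dots> \<le> (\<delta> + \<epsilon> / 8) * (real m * real (m * w))"
        using \<epsilon> by (simp add: algebra_simps)
      also have "\<dots> = \<rho> * ((\<delta> + \<epsilon> / 4) * real m * real (m * w))"
        using \<delta> \<epsilon> by (simp add: \<rho>_def)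
      also have "\<dots> \<le> \<rho> * real ((z - q) * (m * w - k * q))" using X' \<rho> by (intro mult_left_mono) auto
      finally show ?thesis .
    qed
    moreover have "\<rho> ^ q = exp (- c * real q)" using \<rho> by (simp add: c_def exp_of_nat2_mult)
    moreover have "exp (- c * real q) \<le> exp (- c * (\<epsilon> / 8 * real m - 1))" using c q by simp
    then have "4 * real m * exp (- c * real q) \<le> 4 * real m * exp (- c * (\<epsilon> / 8 * real m - 1))"
      by (intro mult_left_mono) auto
    with elim(1) have "4 * real m * exp (- c * real q) \<le> 1" by (rule order_trans[rotated])
    moreover have "real (m - z) \<ge> (1 - \<delta> - \<epsilon>) * real m" using z z2 by (simp add: of_nat_diff algebra_simps)
    moreover have "1 \<le> z" using qz by simp
    ultimately show ?case using qz kq' z2 \<rho> elim(1)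
      by (intro exI[of _ z] exI[of _ q] exI[of _ \<rho>]) auto
  qed
qed

section \<open>Counting Hamilton cycles\<close>

text \<open>Offset \<open>l\<close> is the first position of a block outside the shared part, hence
  in one edge only; these positions are the special ones. They are moved to the end so that fixing
  all other vertices means fixing a prefix of the list.\<close>

lemma obtain_position_bij:
  fixes l w m :: nat
  assumes lw: "l < w" and m: "0 < m"
  obtains \<tau> where "bij_betw \<tau> {..<m * w} {..<m * w}" "\<And>i. i < m \<Longrightarrow> \<tau> (i * w + l) = m * (w - 1) + i"
    "\<And>p. p < m * w \<Longrightarrow> p mod w \<noteq> l \<Longrightarrow> \<tau> p < m * (w - 1)"
proof -
  let ?n = "m * w" and ?N = "m * (w - 1)"
  define P where "P = {p. p < ?n \<and> p mod w \<noteq> l}"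
  define S where "S = (\<lambda>i. i * w + l) ` {..<m}"
  have n: "?n = ?N + m" using lw by (cases w) (auto simp: algebra_simps)
  have S: "S = {p. p < ?n \<and> p mod w = l}"
  proof (intro subset_antisym subsetI)
    fix p assume "p \<in> S"
    then obtain i where "i < m" "p = i * w + l" by (auto simp: S_def)
    then show "p \<in> {p. p < ?n \<and> p mod w = l}" using lw mult_le_mono1[of "Suc i" m w] by simp
  next
    fix p assume p: "p \<in> {p. p < ?n \<and> p mod w = l}"
    then have "p = p div w * w + l" by (metis (mono_tags) div_mult_mod_eq mem_Collect_eq)
    moreover have "p div w < m" using p by (simp add: less_mult_imp_div_less)
    ultimately show "p \<in> S" unfolding S_def by blast
  qed
  have cS: "card S = m" unfolding S_def using lw by (subst card_image) (auto simp: inj_on_def)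
  have "P = {..<?n} - S" by (auto simp: P_def S)
  then have "card P = ?n - m" using cS by (simp add: card_Diff_subset S subset_eq)
  then have "card P = ?N" using n by simp
  then obtain f where f: "bij_betw f P {..<?N}"
    using finite_same_card_bij[of P "{..<?N}"] by (auto simp: P_def)
  define \<tau> where "\<tau> p = (if p mod w = l then ?N + p div w else f p)" for p
  have "bij_betw \<tau> P {..<?N}" using f by (rule bij_betw_cong[THEN iffD1, rotated]) (simp add: \<tau>_def P_def)
  moreover have "bij_betw \<tau> S {?N..<?n}"
  proof (rule bij_betw_imageI)
    show "inj_on \<tau> S" using lw by (auto simp: S_def inj_on_def \<tau>_def)
    have "\<tau> ` S = (\<lambda>i. ?N + i) ` {..<m}" unfolding S_def image_image using lw by (intro image_cong) (auto simp: \<tau>_def)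
    also have "\<dots> = {?N..<?n}" using image_add_atLeastLessThan[of ?N 0 m] n by (simp add: atLeast0LessThan add.commute)
    finally show "\<tau> ` S = {?N..<?n}" .
  qed
  ultimately have "bij_betw \<tau> (P \<union> S) ({..<?N} \<union> {?N..<?n})"
    by (rule bij_betw_combine) auto
  moreover have "P \<union> S = {..<?n}" by (auto simp: P_def S)
  moreover have "{..<?N} \<union> {?N..<?n} = {..<?n}" using n by auto
  ultimately have "bij_betw \<tau> {..<?n} {..<?n}" by simp
  moreover have "\<tau> (i * w + l) = ?N + i" if "i < m" for i using lw by (simp add: \<tau>_def)
  moreover have "\<tau> p < ?N" if "p < ?n" "p mod w \<noteq> l" for p
    using bij_betwE[OF f] that by (auto simp: P_def \<tau>_def)
  ultimately show ?thesis by (rule that)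
qed

text \<open>\<open>M \<le> m\<close> lets one \<rho> serve the rows, with \<open>m\<close> entries,
  and the columns, with \<open>m - 1\<close>.\<close>

lemma card_tail_le:
  fixes V :: "'a set" and S :: "nat \<Rightarrow> nat set" and \<rho> :: real
  assumes V: "finite V" 
    and D: "\<And>A. A \<subseteq> V \<Longrightarrow> card A = k - 1 \<Longrightarrow> card {v\<in>V. insert v A \<notin> E} \<le> D"
    and S: "\<And>i. i < M \<Longrightarrow> S i \<subseteq> {..<card V}" "\<And>i. i < M \<Longrightarrow> card (S i) = k"
    and p: "\<And>i. i < M \<Longrightarrow> p i \<in> S i" "\<And>i i'. i' < i \<Longrightarrow> i < M \<Longrightarrow> p i \<notin> S i'"
    and q: "q \<le> s" and pos: "0 < (s - q) * (card V - k * q)" and M: "M \<le> m"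
    and \<rho>: "real (m * D) \<le> \<rho> * real ((s - q) * (card V - k * q))"
  shows "real (card {ys\<in>permutations_of_set V. s \<le> card {i. i < M \<and> (!) ys ` S i \<notin> E}}) \<le> \<rho> ^ q * fact (card V)"
proof -
  let ?c = "card {ys\<in>permutations_of_set V. s \<le> card {i. i < M \<and> (!) ys ` S i \<notin> E}}"
  let ?X = "(s - q) * (card V - k * q)"
  have "?c * ?X ^ q \<le> (M * D) ^ q * fact (card V)"
    by (rule card_many_nonedges_le[OF V D S p q])
  also have "\<dots> \<le> (m * D) ^ q * fact (card V)"
    using M by (intro mult_le_mono1 power_mono) auto
  finally have "real ?c * real ?X ^ q \<le> real (m * D) ^ q * fact (card V)"
    by (metis (mono_tags) of_nat_fact of_nat_le_iff of_nat_mult of_nat_power)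
  also have "\<dots> \<le> (\<rho> * real ?X) ^ q * fact (card V)"
    using \<rho> by (intro mult_right_mono power_mono) auto
  also have "\<dots> = \<rho> ^ q * fact (card V) * real ?X ^ q" by (simp only: power_mult_distrib mult_ac)
  finally have "real ?c * real ?X ^ q \<le> \<rho> ^ q * fact (card V) * real ?X ^ q" .
  moreover have "0 < real ?X ^ q" using pos by (simp only: zero_less_power of_nat_0_less_iff)
  ultimately show ?thesis by (rule mult_right_le_imp_le)
qed

lemma card_cyclic_orders_ge:
  fixes V :: "'a set" and \<rho> :: real
  defines "n \<equiv> card V"
  assumes lw: "l < w" and m: "3 \<le> m" and w: "2 \<le> w" and V: "finite V" "card V = m * w"
    and D: "\<And>A. A \<subseteq> V \<Longrightarrow> card A = w + l - 1 \<Longrightarrow> card {v\<in>V. insert v A \<notin> E} \<le> D"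
    and z: "1 \<le> z" "2 * z \<le> m" and q: "q \<le> z" and pos: "0 < (z - q) * (m * w - (w + l) * q)" 
    and \<rho>: "real (m * D) \<le> \<rho> * real ((z - q) * (m * w - (w + l) * q))" "4 * real m * \<rho> ^ q \<le> 1"
  shows "fact n / 2 * (real (m - z) ^ m * exp (- real m)) \<le> 
    fact m * real (card {xs\<in>permutations_of_set V. set (edge_list (w + l) w m xs) \<subseteq> E})"
proof -
  define N where "N = m * (w - 1)"
  define k where "k = w + l"
  have n: "n = N + m" "n = m * w" using V(2) w by (auto simp: N_def n_def algebra_simps)
  have "2 * w \<le> m * w" using m by (intro mult_le_mono1) simp
  then have kn: "k \<le> n" using lw unfolding n(2) k_def by linarith
  obtain \<tau> where \<tau>: "bij_betw \<tau> {..<n} {..<n}" "\<And>i. i < m \<Longrightarrow> \<tau> (i * w + l) = N + i"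
    "\<And>p. p < n \<Longrightarrow> p mod w \<noteq> l \<Longrightarrow> \<tau> p < N"
    using obtain_position_bij[OF lw, of m] m unfolding n(2) N_def by (metis less_le_trans zero_less_numeral)
  have \<tau>inj: "\<tau> p = \<tau> p' \<longleftrightarrow> p = p'" if "p < n" "p' < n" for p p'
    using bij_betw_imp_inj_on[OF \<tau>(1)] that by (auto simp: inj_on_eq_iff)
  define pos where "pos i j = (i * w + j) mod n" for i j
  define T where "T i = \<tau> ` pos i ` ({..<k} - {l})" for i
  have pos_lt: "pos i j < n" for i j using m w unfolding pos_def n(2) by simp
  have pos_inj: "inj_on (pos i) {..<k}" for i
  proof (rule inj_onI)
    fix j j' assume "j \<in> {..<k}" "j' \<in> {..<k}" and eq: "pos i j = pos i j'"
    then have lt: "j < n" "j' < n" using kn by auto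
    have "x = y" if "x \<le> y" "y < n" "(i * w + x) mod n = (i * w + y) mod n" for x y
      using mod_eq_dvd_iff_nat[of "i * w + x" "i * w + y" n] that by (auto dest: dvd_imp_le)
    then show "j = j'" using lt eq unfolding pos_def by (metis nat_le_linear)
  qed
  have pos_mod: "pos i j mod w = j mod w" for i j
    unfolding pos_def n(2) by (simp add: mod_mult2_eq mult.commute[of m])
  have pos_l: "pos i l = i * w + l" if "i < m" for i
    using mult_le_mono1[of "Suc i" m w] lw that unfolding pos_def n(2) by simp
  \<comment> \<open>An edge runs past its block by \<open>l\<close> positions, whose offsets are
    below \<open>l\<close>, so it contains no special position but its own.\<close>
  have jl: "j mod w \<noteq> l" if "j < k" "j \<noteq> l" for j
    using that lw by (cases "j < w") (auto simp: k_def mod_if le_mod_geq)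
  have T_lt: "T i \<subseteq> {..<N}" for i
    using \<tau>(3)[OF pos_lt] jl by (auto simp: T_def pos_mod)
  have cT: "card (T i) = k - 1" for i
  proof -
    have "inj_on (\<tau> \<circ> pos i) ({..<k} - {l})"
      using pos_inj[of i] by (auto simp: inj_on_def \<tau>inj pos_lt)
    then have "card (T i) = card ({..<k} - {l})"
      unfolding T_def image_comp by (rule card_image)
    then show ?thesis using lw by (simp add: k_def card_Diff_singleton)
  qed
  have S_eq: "insert (N + i) (T i) = \<tau> ` pos i ` {..<k}" if "i < m" for i
  proof -
    have "{..<k} = insert l ({..<k} - {l})" using lw by (auto simp: k_def)
    then have "\<tau> ` pos i ` {..<k} = insert (\<tau> (pos i l)) (T i)" unfolding T_def by (metis image_insert)
    then show ?thesis using \<tau>(2)[OF that] pos_l[OF that] by simp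
  qed
  have S_sub: "insert (N + j) (T i) \<subseteq> {..<card V}" if "j < m" for i j
    using T_lt[of i] that n unfolding n_def[symmetric] by auto
  have S_card: "card (insert (N + j) (T i)) = k" for i j
  proof -
    have "N + j \<notin> T i" "finite (T i)" using T_lt[of i] finite_subset[OF T_lt[of i]] by auto
    then show ?thesis using cT[of i] w by (simp add: k_def)
  qed
  let ?\<Omega> = "permutations_of_set V"
  let ?bad = "\<lambda>ys i j. (!) ys ` insert (N + j) (T i) \<notin> E"
  define nice where "nice ys \<longleftrightarrow> (\<forall>i<m. card {j. j < m \<and> ?bad ys i j} \<le> z) \<and> 
      (\<forall>j<m. card {i. i < m \<and> ?bad ys i j} \<le> z)" for ys
  define good where "good ys \<longleftrightarrow> (\<forall>i<m. (!) ys ` insert (N + i) (T i) \<in> E)" for ys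
  have fin: "finite ?\<Omega>" by simp
  have D': "card {v\<in>V. insert v A \<notin> E} \<le> D" if "A \<subseteq> V" "card A = k - 1" for A
    using D that by (simp add: k_def)
  have pos': "0 < (z - q) * (card V - k * q)" using pos by (simp add: V(2) k_def)
  have \<rho>': "real (m * D) \<le> \<rho> * real ((z - q) * (card V - k * q))" using \<rho>(1) by (simp add: V(2) k_def)
  \<comment> \<open>Fixed partial edge, varying special vertex: the newly revealed position is the
    special one.\<close>
  have row: "real (card {ys\<in>?\<Omega>. z \<le> card {j. j < m \<and> ?bad ys i j}}) \<le> \<rho> ^ q * fact n" if i: "i < m" for i
    unfolding n_def
  proof (rule card_tail_le[OF V(1) D' S_sub S_card, where p = "\<lambda>j. N + j"])
    fix j j' assume "j' < j" "j < m"
    then show "N + j \<notin> insert (N + j') (T i)" using T_lt[of i] by auto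
  qed (use q pos' \<rho>' in auto)
  \<comment> \<open>The edge with index \<open>m - 1\<close> is left out: it wraps around, so its last position is not new.\<close>
  have col: "real (card {ys\<in>?\<Omega>. z \<le> card {i. i < m - 1 \<and> ?bad ys i j}}) \<le> \<rho> ^ q * fact n" if j: "j < m" for j
    unfolding n_def
  proof (rule card_tail_le[OF V(1) D' S_sub S_card, where p = "\<lambda>i. \<tau> (pos i (k - 1))"])
    \<comment> \<open>Fixed special vertex, varying edge: the newly revealed position is the last
      one of edge \<open>i\<close>, beyond all earlier edges. It is not the special one because
      \<open>w \<ge> 2\<close>.\<close>
    have k1: "k - 1 < k" "k - 1 \<noteq> l" using lw w by (auto simp: k_def)
    show "\<tau> (pos i (k - 1)) \<in> insert (N + j) (T i)" for i using k1 by (auto simp: T_def)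
    fix i i' assume i: "i' < i" "i < m - 1"
    have posi: "pos i'' j = i'' * w + j" if "i'' \<le> i" "j < k" for i'' j
    proof -
      have "(i'' + 2) * w \<le> m * w" using that i by (intro mult_le_mono1) auto
      then have "i'' * w + j < n" using that(2) lw unfolding n(2) by (simp add: k_def)
      then show ?thesis by (simp add: pos_def)
    qed
    have "pos i (k - 1) \<noteq> pos i' j" if "j < k" for j
    proof -
      have "pos i' j = i' * w + j" "pos i (k - 1) = i * w + (k - 1)" using posi i that k1 by auto
      moreover have "i' * w < i * w" using i w by simp
      then have "i' * w + j < i * w + (k - 1)" using that by linarith
      ultimately show ?thesis by (simp only: less_irrefl neq_iff) simp
    qed
    then have "\<tau> (pos i (k - 1)) \<notin> T i'"
      by (auto simp: T_def \<tau>inj pos_lt)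
    moreover have "\<tau> (pos i (k - 1)) < N"
      using \<tau>(3)[OF pos_lt] jl[OF k1] by (simp add: pos_mod)
    ultimately show "\<tau> (pos i (k - 1)) \<notin> insert (N + j) (T i')" by simp
  qed (use q pos' \<rho>' j in auto)
  have "{ys\<in>?\<Omega>. \<not> nice ys} \<subseteq> (\<Union>i<m. {ys\<in>?\<Omega>. z \<le> card {j. j < m \<and> ?bad ys i j}}) \<union>
    (\<Union>j<m. {ys\<in>?\<Omega>. z \<le> card {i. i < m - 1 \<and> ?bad ys i j}})" (is "_ \<subseteq> ?R \<union> ?C")
  proof
    fix ys assume ys: "ys \<in> {ys\<in>?\<Omega>. \<not> nice ys}"
    then consider i where "i < m" "z < card {j. j < m \<and> ?bad ys i j}"
      | j where "j < m" "z < card {i. i < m \<and> ?bad ys i j}" 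
      unfolding nice_def by (force simp: not_le)
    then show "ys \<in> ?R \<union> ?C"
    proof cases
      case 1
      then have "ys \<in> ?R" using ys by (auto intro: less_imp_le)
      then show ?thesis by blast
    next
      case 2
      have "{i. i < m \<and> ?bad ys i j} \<subseteq> insert (m - 1) {i. i < m - 1 \<and> ?bad ys i j}" by auto
      then have "card {i. i < m \<and> ?bad ys i j} \<le> card (insert (m - 1) {i. i < m - 1 \<and> ?bad ys i j})"
        by (intro card_mono) auto
      also have "\<dots> = Suc (card {i. i < m - 1 \<and> ?bad ys i j})" by simp
      \<comment> \<open>A violation is strict, so leaving out edge \<open>m - 1\<close> still leaves
        at least \<open>z\<close>.\<close>
      finally have "z \<le> card {i. i < m - 1 \<and> ?bad ys i j}" using 2(2) by linarith
      then have "ys \<in> ?C" using ys 2(1) by blast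
      then show ?thesis by blast
    qed
  qed
  then have "card {ys\<in>?\<Omega>. \<not> nice ys} \<le> card (?R \<union> ?C)" using fin by (intro card_mono) auto
  also have "\<dots> \<le> card ?R + card ?C" by (rule card_Un_le)
  finally have "real (card {ys\<in>?\<Omega>. \<not> nice ys}) \<le> real (card ?R) + real (card ?C)" by linarith
  also have "real (card ?R) \<le> (\<Sum>i<m. real (card {ys\<in>?\<Omega>. z \<le> card {j. j < m \<and> ?bad ys i j}}))"
    unfolding of_nat_sum[symmetric] of_nat_le_iff by (rule card_UN_le) simp
  also have "\<dots> \<le> real m * (\<rho> ^ q * fact n)"
    using sum_mono[of "{..<m}", OF row] by simp
  also have "real (card ?C) \<le> (\<Sum>j<m. real (card {ys\<in>?\<Omega>. z \<le> card {i. i < m - 1 \<and> ?bad ys i j}}))"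
    unfolding of_nat_sum[symmetric] of_nat_le_iff by (rule card_UN_le) simp
  also have "\<dots> \<le> real m * (\<rho> ^ q * fact n)"
    using sum_mono[of "{..<m}", OF col] by simp
  \<comment> \<open>There are \<open>2 * m\<close> lines; the constant 4 makes the exceptional
    orders at most half of all.\<close>
  finally have "real (card {ys\<in>?\<Omega>. \<not> nice ys}) \<le> (4 * real m * \<rho> ^ q) * (fact n / 2)" by simp
  also have "\<dots> \<le> 1 * (fact n / 2)" using \<rho>(2) by (intro mult_right_mono) auto
  finally have bad: "real (card {ys\<in>?\<Omega>. \<not> nice ys}) \<le> fact n / 2" by simp
  have "card ?\<Omega> = card {ys\<in>?\<Omega>. nice ys} + card {ys\<in>?\<Omega>. \<not> nice ys}"
    using fin by (subst card_Un_disjoint[symmetric]) (auto intro!: arg_cong[where f = card])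
  moreover have "card ?\<Omega> = fact n" unfolding n_def by (rule card_permutations_of_set[OF V(1)])
  ultimately have "real (fact n) = real (card {ys\<in>?\<Omega>. nice ys} + card {ys\<in>?\<Omega>. \<not> nice ys})"
    by (simp only:)
  then have "fact n = real (card {ys\<in>?\<Omega>. nice ys}) + real (card {ys\<in>?\<Omega>. \<not> nice ys})"
    by (simp only: of_nat_fact of_nat_add)
  with bad have nice: "fact n / 2 \<le> real (card {ys\<in>?\<Omega>. nice ys})" by simp
  have "fact n / 2 * (real (m - z) ^ m * exp (- real m)) \<le> 
    real (card {ys\<in>?\<Omega>. nice ys}) * (real (m - z) ^ m * exp (- real m))"
    using nice by (intro mult_right_mono) auto
  also have "\<dots> \<le> fact m * real (card {ys\<in>?\<Omega>. good ys})"
    unfolding nice_def good_def using V n T_lt z by (intro card_completions_ge) (auto simp: n_def)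
  also have "card {ys\<in>?\<Omega>. good ys} \<le> card {xs\<in>?\<Omega>. set (edge_list (w + l) w m xs) \<subseteq> E}"
  \<comment> \<open>Reading \<open>ys\<close> through \<tau> puts each special vertex back at its
    place in the cyclic order.\<close>
  proof (rule card_inj_on_le[of "\<lambda>ys. map (\<lambda>p. ys ! \<tau> p) [0..<n]"])
    have len: "length ys = n" if "ys \<in> ?\<Omega>" for ys
      using that unfolding n_def by (rule length_finite_permutations_of_set)
    have \<tau>lt: "\<tau> p < n" if "p < n" for p using bij_betwE[OF \<tau>(1)] that by auto
    show "inj_on (\<lambda>ys. map (\<lambda>p. ys ! \<tau> p) [0..<n]) {ys\<in>?\<Omega>. good ys}"
    proof (rule inj_onI)
      fix ys ys' assume *: "ys \<in> {ys\<in>?\<Omega>. good ys}" "ys' \<in> {ys\<in>?\<Omega>. good ys}"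
        "map (\<lambda>p. ys ! \<tau> p) [0..<n] = map (\<lambda>p. ys' ! \<tau> p) [0..<n]"
      show "ys = ys'"
      proof (rule nth_equalityI)
        show "length ys = length ys'" using * len by auto
        fix r assume "r < length ys"
        then have "r \<in> {..<n}" using * len by auto
        then obtain p where "p < n" "r = \<tau> p" using bij_betw_imp_surj_on[OF \<tau>(1)] by auto
        then show "ys ! r = ys' ! r" using *(3) by (auto simp: map_eq_conv)
      qed
    qed
    show "(\<lambda>ys. map (\<lambda>p. ys ! \<tau> p) [0..<n]) ` {ys\<in>?\<Omega>. good ys} \<subseteq> 
      {xs\<in>?\<Omega>. set (edge_list (w + l) w m xs) \<subseteq> E}"
    proof (rule image_subsetI)
      fix ys assume ys: "ys \<in> {ys\<in>?\<Omega>. good ys}"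
      let ?xs = "map (\<lambda>p. ys ! \<tau> p) [0..<n]"
      have y: "length ys = n" "distinct ys" "set ys = V" "good ys"
        using ys len by (auto simp: permutations_of_set_def)
      have "set ?xs = (!) ys ` \<tau> ` {..<n}" by (simp add: image_image atLeast0LessThan)
      also have "\<dots> = (!) ys ` {..<n}" using bij_betw_imp_surj_on[OF \<tau>(1)] by simp
      also have "\<dots> = V" using y by (metis nth_image order_refl take_all lessThan_atLeast0)
      finally have "set ?xs = V" .
      moreover have "distinct ?xs"
        using y \<tau>lt \<tau>inj by (auto simp: distinct_map inj_on_def nth_eq_iff_index_eq)
      ultimately have "?xs \<in> ?\<Omega>" by (rule permutations_of_setI)
      moreover have "segment (w + l) ?xs (i * w) \<in> E" if i: "i < m" for i
      proof -
        have "segment (w + l) ?xs (i * w) = (\<lambda>j. ?xs ! pos i j) ` {..<k}"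
          by (auto simp: segment_def pos_def k_def)
        also have "\<dots> = (\<lambda>j. ys ! \<tau> (pos i j)) ` {..<k}"
          using pos_lt by (intro image_cong) auto
        also have "\<dots> = (!) ys ` \<tau> ` pos i ` {..<k}" by (simp only: image_image)
        also have "\<dots> = (!) ys ` insert (N + i) (T i)" by (simp only: S_eq[OF i])
        finally show ?thesis using y(4) i by (simp add: good_def)
      qed
      ultimately show "?xs \<in> {xs\<in>?\<Omega>. set (edge_list (w + l) w m xs) \<subseteq> E}"
        by (auto simp: set_edge_list)
    qed
  qed (use fin in auto)
  finally show ?thesis by simp
qed

lemma card_nonneighbours_le:
  assumes H: "uniform_hypergraph k V E" and k: "1 \<le> k"
    and deg: "\<alpha> * real (card V) \<le> real (min_hyp_degree (k - 1) V E)"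
    and A: "A \<subseteq> V" "card A = k - 1"
  shows "real (card {v\<in>V. insert v A \<notin> E}) \<le> (1 - \<alpha>) * real (card V)"
proof -
  have V: "finite V" and E: "\<And>e. e \<in> E \<Longrightarrow> e \<subseteq> V \<and> card e = k"
    using H by (auto simp: uniform_hypergraph_def)
  have "finite {hyp_degree E A | A. A \<subseteq> V \<and> card A = k - 1}"
    by (rule finite_subset[of _ "hyp_degree E ` Pow V"]) (use V in auto)
  then have "min_hyp_degree (k - 1) V E \<le> hyp_degree E A"
    unfolding min_hyp_degree_def using A by (intro Min_le) auto
  also have "\<dots> \<le> card {v\<in>V. insert v A \<in> E}"
  proof -
    have "{f\<in>E. A \<subseteq> f} \<subseteq> (\<lambda>v. insert v A) ` {v\<in>V. insert v A \<in> E}"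
    proof
      fix f assume f: "f \<in> {f\<in>E. A \<subseteq> f}"
      then have "f \<subseteq> V" "card f = k" "A \<subseteq> f" using E by auto
      then have "finite f" "card (f - A) = 1" using V A k finite_subset
        by (auto simp: card_Diff_subset finite_subset)
      then obtain v where v: "f - A = {v}" by (auto simp: card_1_singleton_iff)
      then have "f = insert v A" "v \<in> V" using \<open>A \<subseteq> f\<close> \<open>f \<subseteq> V\<close> by auto
      then show "f \<in> (\<lambda>v. insert v A) ` {v\<in>V. insert v A \<in> E}" using f by blast
    qed
    then have "hyp_degree E A \<le> card ((\<lambda>v. insert v A) ` {v\<in>V. insert v A \<in> E})"
      unfolding hyp_degree_def using V by (intro card_mono) auto
    also have "\<dots> \<le> card {v\<in>V. insert v A \<in> E}" using V by (intro card_image_le) auto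
    finally show ?thesis .
  qed
  finally have "\<alpha> * real (card V) \<le> real (card {v\<in>V. insert v A \<in> E})" using deg by linarith
  moreover have "card V = card {v\<in>V. insert v A \<in> E} + card {v\<in>V. insert v A \<notin> E}"
    using V by (subst card_Un_disjoint[symmetric]) (auto intro!: arg_cong[where f = card])
  ultimately show ?thesis by (simp add: algebra_simps)
qed

text \<open>For \<open>l = 0\<close> even the complete hypergraph has only n! / (k!^(n/k) (n/k)!)
  perfect matchings, and (n/k)! outgrows every exponential, so the bound is stated for matchings
  with ordered edges. For \<open>l > 0\<close> the corresponding factor is polynomial in
  \<open>n\<close> and disappears in the power of 1 - \<gamma>.\<close>

theorem theorem1p1:
  fixes k l :: nat and \<alpha> \<gamma> :: real
  assumes "2 \<le> k" and "real l < real k / 2"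
    and "1/2 < \<alpha>" and "\<alpha> \<le> 1"
    and "0 < \<gamma>" and "\<gamma> < 1"
  shows "\<exists>n0::nat. \<forall>n\<ge>n0. \<forall>(V::'a set) E.
    (k - l) dvd n \<longrightarrow>
    uniform_hypergraph k V E \<longrightarrow> card V = n \<longrightarrow>
    \<alpha> * real n \<le> real (min_hyp_degree (k - 1) V E) \<longrightarrow>
    real (card (hamilton_cycles k l V E)) * (if l = 0 then fact (n div k) else 1)
      \<ge> (1 - \<gamma>) ^ n * fact n *
         (\<alpha> / (fact l * fact (k - 2 * l))) powr (real n / real (k - l))"
proof -
  define w where "w = k - l"
  have lk: "2 * l < k" using assms(2) by simp
  have kw: "k = w + l" and lw: "l < w" and w: "2 \<le> w" and wl: "w - l = k - 2 * l"
    using lk assms(1) by (auto simp: w_def)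
  \<comment> \<open>The first bound gives (1 - \<alpha>) + \<epsilon> at most 1/2, hence
    \<open>2 * z \<le> m\<close>; the second gives \<alpha> - \<epsilon> at least \<alpha> (1 -
    \<gamma> / 2).\<close>
  define \<epsilon> where "\<epsilon> = min (\<alpha> - 1/2) (\<alpha> * \<gamma> / 2)"
  have \<epsilon>: "0 < \<epsilon>" "\<epsilon> \<le> \<alpha> - 1/2" "\<epsilon> \<le> \<alpha> * \<gamma> / 2" unfolding \<epsilon>_def using assms by (simp, intro min.cobounded1, intro min.cobounded2)
  \<comment> \<open>The factor 1 - \<gamma> is split: 1 - \<gamma> / 2 pays for \<epsilon>, and the
    remaining ratio absorbs the polynomial factors.\<close>
  define r where "r = (1 - \<gamma>) / (1 - \<gamma> / 2)"
  have r: "0 < r" "r < 1" using assms by (auto simp: r_def)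
  have "eventually (\<lambda>m. \<exists>z q \<rho>. 1 \<le> z \<and> 2 * z \<le> m \<and> q \<le> z \<and> 0 < (z - q) * (m * w - (w + l) * q) \<and>
    real (m - z) \<ge> (1 - (1 - \<alpha>) - \<epsilon>) * real m \<and>
    (\<forall>D. real D \<le> (1 - \<alpha>) * real (m * w) \<longrightarrow> real (m * D) \<le> \<rho> * real ((z - q) * (m * w - (w + l) * q))) \<and> 
    4 * real m * \<rho> ^ q \<le> 1) sequentially"
    using assms \<epsilon> lw by (intro eventually_tail_parameters) auto
  \<comment> \<open>One factor \<open>m\<close> comes from \<open>fact_le_power_exp\<close>, two
    from the edge lists of a cycle with \<open>l > 0\<close>; the constant combines the e of that
    lemma with the half of the orders that is kept.\<close>
  moreover have "eventually (\<lambda>m::nat. (2 * exp 1) * real m ^ 3 * r ^ m \<le> 1) sequentially"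
    by (rule eventually_poly_geometric_le[OF r])
  moreover have "eventually (\<lambda>m::nat. 3 \<le> m) sequentially" by (rule eventually_ge_at_top)
  ultimately have "eventually (\<lambda>m. (\<exists>z q \<rho>. 1 \<le> z \<and> 2 * z \<le> m \<and> q \<le> z \<and> 0 < (z - q) * (m * w - (w + l) * q) \<and>
    real (m - z) \<ge> (1 - (1 - \<alpha>) - \<epsilon>) * real m \<and>
    (\<forall>D. real D \<le> (1 - \<alpha>) * real (m * w) \<longrightarrow> real (m * D) \<le> \<rho> * real ((z - q) * (m * w - (w + l) * q))) \<and> 
    4 * real m * \<rho> ^ q \<le> 1) \<and> (2 * exp 1) * real m ^ 3 * r ^ m \<le> 1 \<and> 3 \<le> m) sequentially"
    by eventually_elim blast
  then obtain m0 where m0: "\<And>m. m0 \<le> m \<Longrightarrow> (\<exists>z q \<rho>. 1 \<le> z \<and> 2 * z \<le> m \<and> q \<le> z \<and> 0 < (z - q) * (m * w - (w + l) * q) \<and>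
    real (m - z) \<ge> (1 - (1 - \<alpha>) - \<epsilon>) * real m \<and>
    (\<forall>D. real D \<le> (1 - \<alpha>) * real (m * w) \<longrightarrow> real (m * D) \<le> \<rho> * real ((z - q) * (m * w - (w + l) * q))) \<and> 
    4 * real m * \<rho> ^ q \<le> 1) \<and> (2 * exp 1) * real m ^ 3 * r ^ m \<le> 1 \<and> 3 \<le> m"
    unfolding eventually_sequentially by blast
  show ?thesis
  proof (intro exI[of _ "m0 * w"] allI impI)
    fix n and V :: "'a set" and E
    assume n: "m0 * w \<le> n" and dvd: "(k - l) dvd n" and H: "uniform_hypergraph k V E" and cV: "card V = n"
      and deg: "\<alpha> * real n \<le> real (min_hyp_degree (k - 1) V E)"
    define m where "m = n div w"
    have nm: "n = m * w" using dvd by (simp add: m_def w_def)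
    have "m0 \<le> m" using n w unfolding nm by simp
    from m0[OF this] obtain z q \<rho> where z: "1 \<le> z" "2 * z \<le> m" and q: "q \<le> z" 
      and pos: "0 < (z - q) * (m * w - (w + l) * q)"
      and mz: "real (m - z) \<ge> (1 - (1 - \<alpha>) - \<epsilon>) * real m"
      and \<rho>: "\<And>D. real D \<le> (1 - \<alpha>) * real (m * w) \<Longrightarrow> real (m * D) \<le> \<rho> * real ((z - q) * (m * w - (w + l) * q))"
        "4 * real m * \<rho> ^ q \<le> 1"
      and rm: "(2 * exp 1) * real m ^ 3 * r ^ m \<le> 1" and m3: "3 \<le> m" by blast
    have V: "finite V" "card V = m * w" using H cV nm by (auto simp: uniform_hypergraph_def)
    have "E \<subseteq> Pow V" using H by (auto simp: uniform_hypergraph_def)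
    then have E: "finite E" using V finite_subset by blast
    define D where "D = nat \<lfloor>(1 - \<alpha>) * real n\<rfloor>"
    have D: "real D \<le> (1 - \<alpha>) * real (m * w)" using assms nm by (simp add: D_def)
    have D': "card {v\<in>V. insert v A \<notin> E} \<le> D" if "A \<subseteq> V" "card A = w + l - 1" for A
    proof -
      have "real (card {v\<in>V. insert v A \<notin> E}) \<le> (1 - \<alpha>) * real (card V)"
        by (rule card_nonneighbours_le[OF H]) (use assms deg cV that kw in auto)
      then show ?thesis unfolding D_def cV by (rule le_nat_floor)
    qed
    define X where "X = card {xs\<in>permutations_of_set V. set (edge_list (w + l) w m xs) \<subseteq> E}"
    define h where "h = card (hamilton_cycles k l V E)"
    define B :: real where "B = fact l * fact (k - 2 * l)"
    define Q :: real where "Q = (if l = 0 then fact m else real m ^ 2)"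
    have B: "0 < B" by (simp add: B_def)
    have m: "0 < real m" using m3 by simp
    have lower: "fact n / 2 * (real (m - z) ^ m * exp (- real m)) \<le> fact m * real X"
      using card_cyclic_orders_ge[OF lw m3 w V D' z q pos \<rho>(1)[OF D] \<rho>(2)] by (simp add: X_def cV)
    have "X \<le> h * ((if l = 0 then fact m else m\<^sup>2) * (fact l * fact (w - l)) ^ m)"
      unfolding X_def h_def kw by (rule card_cyclic_orders_le[OF lw m3 V E])
    then have "real X \<le> real (h * ((if l = 0 then fact m else m\<^sup>2) * (fact l * fact (w - l)) ^ m))"
      by (simp only: of_nat_le_iff)
    also have "\<dots> = real h * Q * B ^ m" by (simp add: Q_def B_def wl)
    finally have upper: "real X \<le> real h * Q * B ^ m" .
    define a where "a = \<alpha> - \<epsilon>"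
    have "\<alpha> * \<gamma> / 2 < \<alpha>" using assms by (simp add: field_simps)
    then have a: "0 < a" using \<epsilon> by (simp add: a_def)
    have fm: "fact m \<le> exp 1 * real m * (real m ^ m * exp (- real m))"
      using fact_le_power_exp[of m] m3 by (simp add: exp_minus field_simps)
    have "fact n / 2 * a ^ m * (real m ^ m * exp (- real m)) = fact n / 2 * ((a * real m) ^ m * exp (- real m))"
      by (simp add: power_mult_distrib)
    also have "\<dots> \<le> fact n / 2 * (real (m - z) ^ m * exp (- real m))"
      using mz a m by (intro mult_left_mono mult_right_mono power_mono) (auto simp: a_def)
    also have "\<dots> \<le> fact m * real X" by (rule lower)
    also have "\<dots> \<le> exp 1 * real m * (real m ^ m * exp (- real m)) * real X"
      using fm by (intro mult_right_mono) auto
    also have "\<dots> = exp 1 * real m * real X * (real m ^ m * exp (- real m))" by simp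
    finally have "fact n / 2 * a ^ m \<le> exp 1 * real m * real X"
      using m by (simp only: mult_le_cancel_right) (simp add: not_less)
    also have "\<dots> \<le> exp 1 * real m * (real h * Q * B ^ m)" using upper by (intro mult_left_mono) auto
    finally have main: "fact n * a ^ m \<le> 2 * exp 1 * real m * (real h * Q) * B ^ m" by simp
    \<comment> \<open>The whole loss is an \<open>m\<close>-th power, so \<open>m\<close> of the
      \<open>n\<close> factors cover it.\<close>
    have "(1 - \<gamma>) ^ n \<le> (1 - \<gamma>) ^ m" using assms w nm by (intro power_decreasing) auto
    also have "\<dots> = r ^ m * (1 - \<gamma> / 2) ^ m" using assms by (simp add: r_def power_divide)
    finally have "(1 - \<gamma>) ^ n * \<alpha> ^ m \<le> r ^ m * ((1 - \<gamma> / 2) ^ m * \<alpha> ^ m)"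
      using assms mult_right_mono[of "(1 - \<gamma>) ^ n" _ "\<alpha> ^ m"] by (simp add: mult.assoc)
    also have "(1 - \<gamma> / 2) ^ m * \<alpha> ^ m = (\<alpha> - \<alpha> * \<gamma> / 2) ^ m"
      by (simp add: power_mult_distrib[symmetric] algebra_simps)
    also have "r ^ m * \<dots> \<le> r ^ m * a ^ m"
      using assms \<epsilon> r by (intro mult_left_mono power_mono) (auto simp: a_def field_simps)
    finally have "(1 - \<gamma>) ^ n * \<alpha> ^ m * fact n \<le> r ^ m * a ^ m * fact n" by (rule mult_right_mono) simp
    also have "\<dots> = r ^ m * (fact n * a ^ m)" by simp
    also have "\<dots> \<le> r ^ m * (2 * exp 1 * real m * (real h * Q) * B ^ m)"
      using main r by (intro mult_left_mono) auto
    finally have step: "(1 - \<gamma>) ^ n * \<alpha> ^ m * fact n / B ^ m \<le> (2 * exp 1 * real m * r ^ m) * (real h * Q)"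
      using B by (simp add: field_simps)
    have goal: "(1 - \<gamma>) ^ n * fact n * (\<alpha> / B) ^ m \<le> (2 * exp 1 * real m * r ^ m) * (real h * Q)"
      using step by (simp add: power_divide mult_ac)
    also have "\<dots> \<le> real h * (if l = 0 then fact (n div k) else 1)"
    proof (cases "l = 0")
      case True
      have "real m \<le> real m ^ 3" using m3 by (intro self_le_power) auto
      then have "2 * exp 1 * real m * r ^ m \<le> 2 * exp 1 * real m ^ 3 * r ^ m"
        using r by (intro mult_right_mono mult_left_mono) auto
      with rm have "2 * exp 1 * real m * r ^ m \<le> 1" by linarith
      then have "(2 * exp 1 * real m * r ^ m) * (real h * Q) \<le> 1 * (real h * Q)"
        by (intro mult_right_mono) (auto simp: Q_def)
      then show ?thesis using True nm w kw by (simp add: Q_def)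
    next
      case False
      have "(2 * exp 1 * real m * r ^ m) * (real h * Q) = (2 * exp 1 * real m ^ 3 * r ^ m) * real h"
        using False by (simp add: Q_def power2_eq_square power3_eq_cube)
      also have "\<dots> \<le> 1 * real h" using rm by (intro mult_right_mono) auto
      finally show ?thesis using False by simp
    qed
    finally have "(1 - \<gamma>) ^ n * fact n * (\<alpha> / B) ^ m \<le> real h * (if l = 0 then fact (n div k) else 1)" .
    moreover have "(\<alpha> / B) powr (real n / real (k - l)) = (\<alpha> / B) ^ m"
    proof -
      have "real n / real (k - l) = real m" using nm w unfolding w_def[symmetric] by simp
      then show ?thesis using B assms by (simp add: powr_realpow)
    qed
    ultimately show "real (card (hamilton_cycles k l V E)) * (if l = 0 then fact (n div k) else 1)
      \<ge> (1 - \<gamma>) ^ n * fact n * (\<alpha> / (fact l * fact (k - 2 * l))) powr (real n / real (k - l))"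
      by (simp only: h_def B_def)
  qed
qed

end
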